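(* Let $\mathfrak E'=\{x\in\ell^2: x_n\in\mathbb Q+\sqrt2\text{ for all }n<\omega\}$ and $\mathfrak E_{\mathrm c}=\{x\in\ell^2:x_n\in\mathbb P\text{ for all }n<\omega\}$, where $\mathbb P$ is the set of irrational numbers. Then the subspace $$X:=\mathfrak E'\cup\{x\in\mathfrak E_{\mathrm c}:\|x\|\in\mathbb Q\}$$ of $\ell^2$ (with the norm topology) is an almost zero-dimensional $F_{\sigma\delta}$-space which is not an Erdős space factor.
   Context: All spaces are non-empty, separable and metrizable. $\mathbb Q+\sqrt 2=\{q+\sqrt2:q\in\mathbb Q\}$ and $\|\cdot\|$ is the $\ell^2$-norm. A subset $A$ of a space $X$ is a C-set in $X$ if $A$ is an intersection of clopen subsets of $X$. A space $X$ is almost zero-dimensional if every point of $X$ has a neighborhood basis consisting of C-sets of $X$ (neighborhoods need not be open). An $F_{\sigma\delta}$-space is an absolute $F_{\sigma\delta}$ space, i.e. one which is an $F_{\sigma\delta}$-subset of every separable metrizable space in which it is embedded (equivalently, an $F_{\sigma\delta}$-subset of some completely metrizable separable space). The Erdős space is $\mathfrak E=\{x\in\ell^2: x_n\in\mathbb Q\text{ for all }n<\omega\}$ with the norm topology of $\ell^2$. A space $X$ is an Erdős space factor if there is a space $Y$ such that $X\times Y$ is homeomorphic to $\mathfrak E$. *)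

theory Defs
  imports "HOL-Analysis.Analysis"
begin

definition l2 :: "(nat \<Rightarrow> real) set" where
  "l2 = {x. (\<lambda>n. (x n)\<^sup>2) summable_on UNIV}"

(* infsum is 0 on families that are not summable, which makes the distance below
   nonnegative on all pairs of sequences, as the locale Metric_space requires. *)
definition l2_norm :: "(nat \<Rightarrow> real) \<Rightarrow> real" where
  "l2_norm x = sqrt (\<Sum>\<^sub>\<infinity>n. (x n)\<^sup>2)"

definition l2_dist :: "(nat \<Rightarrow> real) \<Rightarrow> (nat \<Rightarrow> real) \<Rightarrow> real" where
  "l2_dist x y = l2_norm (\<lambda>n. x n - y n)"

definition l2_topology :: "(nat \<Rightarrow> real) topology" where
  "l2_topology = Metric_space.mtopology l2 l2_dist"

lemma l2_diff:
  assumes "x \<in> l2" "y \<in> l2"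
  shows "(\<lambda>n. x n - y n) \<in> l2"
proof -
  have "(\<lambda>n. 2 * (x n)\<^sup>2 + 2 * (y n)\<^sup>2) summable_on UNIV"
    using assms unfolding l2_def
    by (intro summable_on_add summable_on_cmult_right) auto
  moreover have "(x n - y n)\<^sup>2 \<le> 2 * (x n)\<^sup>2 + 2 * (y n)\<^sup>2" for n
    using zero_le_power2[of "x n + y n"] by (simp add: power2_eq_square algebra_simps)
  ultimately show ?thesis
    unfolding l2_def by (auto intro: summable_on_comparison_test)
qed

lemma L2_set_le_l2_norm:
  assumes "x \<in> l2" "finite F"
  shows "L2_set x F \<le> l2_norm x"
  unfolding L2_set_def l2_norm_def
  using assms by (auto simp: l2_def intro!: finite_sum_le_infsum)

lemma l2_norm_nonneg: "0 \<le> l2_norm x"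
  by (simp add: l2_norm_def infsum_nonneg)

lemma l2_norm_add_le:
  assumes "x \<in> l2" "y \<in> l2" "(\<lambda>n. x n + y n) \<in> l2"
  shows "l2_norm (\<lambda>n. x n + y n) \<le> l2_norm x + l2_norm y"
proof -
  have "(\<Sum>\<^sub>\<infinity>n. (x n + y n)\<^sup>2) \<le> (l2_norm x + l2_norm y)\<^sup>2"
  proof (rule infsum_le_finite_sums)
    show "(\<lambda>n. (x n + y n)\<^sup>2) summable_on UNIV"
      using assms(3) by (simp add: l2_def)
    fix F :: "nat set" assume F: "finite F"
    have "L2_set (\<lambda>n. x n + y n) F \<le> L2_set x F + L2_set y F"
      by (rule L2_set_triangle_ineq)
    also have "\<dots> \<le> l2_norm x + l2_norm y"
      using L2_set_le_l2_norm assms F by (meson add_mono)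
    finally show "(\<Sum>n\<in>F. (x n + y n)\<^sup>2) \<le> (l2_norm x + l2_norm y)\<^sup>2"
      unfolding L2_set_def by (rule sqrt_le_D)
  qed
  then show ?thesis
    unfolding l2_norm_def[of "\<lambda>n. x n + y n"]
    by (intro real_le_lsqrt add_nonneg_nonneg l2_norm_nonneg)
qed

lemma Metric_space_l2: "Metric_space l2 l2_dist"
proof
  fix x y z :: "nat \<Rightarrow> real"
  show "0 \<le> l2_dist x y"
    by (simp add: l2_dist_def l2_norm_nonneg)
  show "l2_dist x y = l2_dist y x"
    by (simp add: l2_dist_def l2_norm_def power2_commute)
  assume x: "x \<in> l2" and y: "y \<in> l2"
  show "l2_dist x y = 0 \<longleftrightarrow> x = y"
  proof
    assume 0: "l2_dist x y = 0"
    have "x n = y n" for n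
      using L2_set_le_l2_norm[OF l2_diff[OF x y], of "{n}"] 0
      by (simp add: l2_dist_def L2_set_def)
    then show "x = y" by blast
  qed (simp add: l2_dist_def l2_norm_def)
  assume z: "z \<in> l2"
  show "l2_dist x z \<le> l2_dist x y + l2_dist y z"
    using l2_norm_add_le[OF l2_diff[OF x y] l2_diff[OF y z]] l2_diff[OF x z]
    by (simp add: l2_dist_def)
qed

lemma topspace_l2_topology [simp]: "topspace l2_topology = l2"
  by (simp add: l2_topology_def Metric_space.topspace_mtopology[OF Metric_space_l2])

(* Standing assumption: all spaces are non-empty, separable and metrizable. *)
definition sm_space :: "'a topology \<Rightarrow> bool" where
  "sm_space X \<longleftrightarrow> topspace X \<noteq> {} \<and> separable_space X \<and> metrizable_space X"

definition C_set_in :: "'a topology \<Rightarrow> 'a set \<Rightarrow> bool" where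
  "C_set_in X A \<longleftrightarrow>
     (\<exists>\<U>. \<U> \<noteq> {} \<and> (\<forall>U\<in>\<U>. openin X U \<and> closedin X U) \<and> A = \<Inter>\<U>)"

(* In neighbourhood_base_of the basic sets need not be open. *)
definition almost_zero_dimensional :: "'a topology \<Rightarrow> bool" where
  "almost_zero_dimensional X \<longleftrightarrow> sm_space X \<and> neighbourhood_base_of (C_set_in X) X"

definition fsigmadelta_in :: "'a topology \<Rightarrow> 'a set \<Rightarrow> bool" where
  "fsigmadelta_in X = (countable intersection_of fsigma_in X) relative_to topspace X"

(* HOL cannot quantify over types inside a formula: the type argument is the type
   of the points of the ambient spaces Z, and is left arbitrary in a theorem. *)
definition absolute_fsigmadelta :: "'b itself \<Rightarrow> 'a topology \<Rightarrow> bool" where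
  "absolute_fsigmadelta _ X \<longleftrightarrow> sm_space X \<and>
     (\<forall>(Z :: 'b topology) f. sm_space Z \<and> embedding_map X Z f
        \<longrightarrow> fsigmadelta_in Z (f ` topspace X))"

definition Erdos_space :: "(nat \<Rightarrow> real) topology" where
  "Erdos_space = subtopology l2_topology {x \<in> l2. \<forall>n. x n \<in> \<rat>}"

(* As above, the type argument is the type of the points of the cofactor Y. *)
definition Erdos_space_factor :: "'b itself \<Rightarrow> 'a topology \<Rightarrow> bool" where
  "Erdos_space_factor _ X \<longleftrightarrow>
     (\<exists>Y :: 'b topology. sm_space Y \<and> prod_topology X Y homeomorphic_space Erdos_space)"

definition E_prime :: "(nat \<Rightarrow> real) set" where
  "E_prime = {x \<in> l2. \<forall>n. x n \<in> (\<lambda>q. q + sqrt 2) ` \<rat>}"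

definition E_c :: "(nat \<Rightarrow> real) set" where
  "E_c = {x \<in> l2. \<forall>n. x n \<notin> \<rat>}"

end

theory Submission
  imports Defs
begin

text \<open>
  Call the topology of coordinatewise convergence weak. Norm balls are weakly closed, so norm-open sets
  are weakly $F_\sigma$, and norm and weak topology agree on spheres.

  If $X \times Y$ is homeomorphic to the Erdos space, then $X$ is embedded in it as a closed set by
  some $h$. The graph $\{(h(x), x) : x \in X\}$ is norm-closed in the product of the Erdos space and
  $\ell^2$, hence it is a weak $F_{\sigma\delta}$-set $\bigcap_n G_n$ of
  $\mathbb{R}^\omega \times \mathbb{R}^\omega$. Let $S_q$ be the set of the
  points of norm $q$ with irrational coordinates; for rational $q$ it is a Polish subspace of $X$. Erdos'
  argument, carried out inside $E'$ and stopped as soon as the norm reaches $q$, shows that every point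
  of $X \cap V$ of norm less than $q$, with $V$ weakly open, is a weak limit of points of
  $S_q \cap V$, even when their images under $h$ are taken into account. With the Baire category theorem
  on $S_{q_n}$ one finds rational $q_0 > q_1 > \dots$ and weakly open $V_n$ such that the graph over
  $S_{q_n} \cap V_n$ lies in one closed piece of $G_n$ and in the closure of the graph over
  $S_{q_{n-1}} \cap V_{n-1}$. The limit $(h(x), x)$ is in all $G_n$, so $x \in X$; but the pieces can be
  chosen so as to miss, one at a time, all rational norms and all elements of
  $\mathbb{Q} + \sqrt 2$ as first coordinate, so $x \notin X$.
\<close>

section \<open>Absolute $F_{\sigma\delta}$-spaces\<close>

lemma fsigma_in_continuous_map_preimage:
  assumes "continuous_map X Y f" "fsigma_in Y S"
  shows "fsigma_in X {x \<in> topspace X. f x \<in> S}"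
proof -
  obtain C where C: "\<And>n::nat. closedin Y (C n)" and S: "S = \<Union> (range C)"
    using assms(2) by (auto simp: fsigma_in_ascending)
  have "{x \<in> topspace X. f x \<in> S} = \<Union> (range (\<lambda>n. {x \<in> topspace X. f x \<in> C n}))"
    by (auto simp: S)
  moreover have "fsigma_in X (\<Union> (range (\<lambda>n. {x \<in> topspace X. f x \<in> C n})))"
    using closedin_continuous_map_preimage[OF assms(1) C]
    by (intro fsigma_in_Union) (auto intro: closed_imp_fsigma_in)
  ultimately show ?thesis by simp
qed

text \<open>The clause \<open>relative_to topspace X\<close> takes care of the empty intersection,
  which is \<open>UNIV\<close>. Since the whole space is itself F_sigma, intersecting with it
  preserves the class.\<close>

lemma fsigmadelta_in_alt:
  "fsigmadelta_in X S \<longleftrightarrow> S \<subseteq> topspace X \<and> (countable intersection_of fsigma_in X) S"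
proof -
  have "(countable intersection_of fsigma_in X) (topspace X)"
    by (simp add: countable_intersection_of_inc)
  then show ?thesis
    unfolding fsigmadelta_in_def
    by (metis countable_intersection_of_inter relative_to_def relative_to_imp_subset relative_to_subset_inc)
qed

lemma fsigma_imp_fsigmadelta_in: "fsigma_in X S \<Longrightarrow> fsigmadelta_in X S"
  by (simp add: fsigmadelta_in_alt countable_intersection_of_inc fsigma_in_subset)

lemma fsigmadelta_in_Int:
  "fsigmadelta_in X S \<Longrightarrow> fsigmadelta_in X T \<Longrightarrow> fsigmadelta_in X (S \<inter> T)"
  by (auto simp: fsigmadelta_in_alt intro: countable_intersection_of_inter)

lemma fsigmadelta_in_Un:
  "fsigmadelta_in X S \<Longrightarrow> fsigmadelta_in X T \<Longrightarrow> fsigmadelta_in X (S \<union> T)"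
  by (auto simp: fsigmadelta_in_alt intro: countable_intersection_of_union fsigma_in_Un)

lemma fsigmadelta_in_INT:
  assumes "\<And>n::nat. fsigmadelta_in X (G n)"
  shows "fsigmadelta_in X (\<Inter>n. G n)"
proof -
  have "(countable intersection_of fsigma_in X) (\<Inter>n. G n)"
    using assms by (intro countable_intersection_of_INT) (auto simp: fsigmadelta_in_alt)
  then show ?thesis
    using assms by (auto simp: fsigmadelta_in_alt)
qed

lemma fsigmadelta_in_sequence:
  assumes "fsigmadelta_in X S"
  obtains G where "\<And>n::nat. fsigma_in X (G n)" "S = (\<Inter>n. G n)"
proof -
  obtain \<U> where \<U>: "countable \<U>" "\<U> \<subseteq> Collect (fsigma_in X)" "\<Inter>\<U> = S"
    using assms by (auto simp: fsigmadelta_in_alt intersection_of_def)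
  \<comment> \<open>The extra member makes the family nonempty, so that \<open>from_nat_into\<close>
    enumerates it, and leaves the intersection \<open>S\<close> unchanged.\<close>
  define \<V> where "\<V> = insert (topspace X) \<U>"
  have \<V>: "countable \<V>" "\<V> \<noteq> {}" "\<And>V. V \<in> \<V> \<Longrightarrow> fsigma_in X V"
    using \<U> by (auto simp: \<V>_def)
  have "\<Inter>\<V> = S"
    using \<U>(3) assms by (auto simp: \<V>_def fsigmadelta_in_alt)
  moreover have "range (from_nat_into \<V>) = \<V>"
    using \<V> by (intro range_from_nat_into)
  ultimately show ?thesis
    using \<V> that[of "from_nat_into \<V>"] by (metis from_nat_into)
qed

lemma fsigmadelta_in_continuous_map_preimage:
  assumes f: "continuous_map X Y f" and S: "fsigmadelta_in Y S"
  shows "fsigmadelta_in X {x \<in> topspace X. f x \<in> S}"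
proof -
  obtain G where G: "\<And>n::nat. fsigma_in Y (G n)" "S = (\<Inter>n. G n)"
    using fsigmadelta_in_sequence[OF S] by blast
  have "{x \<in> topspace X. f x \<in> S} = (\<Inter>n. {x \<in> topspace X. f x \<in> G n})"
    using G by auto
  then show ?thesis
    using fsigmadelta_in_INT[OF fsigma_imp_fsigmadelta_in[OF fsigma_in_continuous_map_preimage[OF f G(1)]]] by simp
qed

lemma fsigmadelta_in_subtopology:
  assumes "fsigmadelta_in (subtopology X U) S"
  obtains T where "fsigmadelta_in X T" "S = T \<inter> U"
proof -
  obtain G where G: "\<And>n::nat. fsigma_in (subtopology X U) (G n)" "S = (\<Inter>n. G n)"
    using fsigmadelta_in_sequence[OF assms] by blast
  then have "\<forall>n. \<exists>T. fsigma_in X T \<and> G n = T \<inter> U"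
    by (simp add: fsigma_in_subtopology)
  then obtain T where T: "\<And>n. fsigma_in X (T n)" "\<And>n. G n = T n \<inter> U"
    by metis
  show ?thesis
    using that[OF fsigmadelta_in_INT[OF fsigma_imp_fsigmadelta_in[OF T(1)]]] G(2) T(2) by auto
qed

lemma gdelta_imp_fsigmadelta_in:
  assumes "metrizable_space X" "gdelta_in X S"
  shows "fsigmadelta_in X S"
proof -
  obtain C where C: "\<And>n::nat. openin X (C n)" "S = (\<Inter>n. C n)"
    using assms(2) by (auto simp: gdelta_in_descending)
  show ?thesis
    unfolding C(2) by (intro fsigmadelta_in_INT fsigma_imp_fsigmadelta_in open_imp_fsigma_in assms(1) C(1))
qed

text \<open>The image of the embedding \<open>f\<close> is the preimage of \<open>A\<close> under an extension \<open>g\<close> of its inverse to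
  a $G_\delta$-set: \<open>f \<circ> g\<close> is the identity on a dense subset of that preimage, hence on all of it.\<close>

lemma absolute_fsigmadelta_completely_metrizable:
  assumes C: "completely_metrizable_space C" and A: "fsigmadelta_in C A"
    and sm: "sm_space (subtopology C A)"
  shows "absolute_fsigmadelta TYPE('z) (subtopology C A)"
  unfolding absolute_fsigmadelta_def
proof (intro conjI allI impI sm, elim conjE)
  fix Z :: "'z topology" and f
  assume Z: "sm_space Z" and f: "embedding_map (subtopology C A) Z f"
  have AC: "A \<subseteq> topspace C"
    using A by (simp add: fsigmadelta_in_alt)
  then have tA: "topspace (subtopology C A) = A"
    by auto
  let ?S = "f ` A"
  have mZ: "metrizable_space Z"
    using Z by (simp add: sm_space_def)
  obtain k where k: "homeomorphic_maps (subtopology C A) (subtopology Z ?S) f k"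
    using f unfolding embedding_map_def tA homeomorphic_map_maps by blast
  have contf: "continuous_map (subtopology C A) Z f"
    using k by (auto simp: homeomorphic_maps_def continuous_map_in_subtopology)
  then have SZ: "?S \<subseteq> topspace Z"
    using tA by (auto simp: continuous_map_def)
  have kf: "k (f x) = x" if "x \<in> A" for x
    using k that tA by (auto simp: homeomorphic_maps_def)
  have contk: "continuous_map (subtopology Z ?S) C k"
    using k by (auto simp: homeomorphic_maps_def continuous_map_in_subtopology)
  obtain G g where G: "gdelta_in Z G" "?S \<subseteq> G" "G \<subseteq> Z closure_of ?S"
      and g: "continuous_map (subtopology Z G) C g" and gk: "\<And>x. x \<in> ?S \<Longrightarrow> g x = k x"
    by (rule Lavrentiev_extension[OF SZ disjI1[OF mZ] C contk]) (rule that, assumption+)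
  define H where "H = {z \<in> topspace (subtopology Z G). g z \<in> A}"
  have "?S \<subseteq> H"
    using G gk kf SZ by (auto simp: H_def)
  moreover have "H \<subseteq> ?S"
  proof
    fix z assume z: "z \<in> H"
    have SH: "?S \<subseteq> H" by fact
    have HG: "H \<subseteq> G"
      by (auto simp: H_def)
    have "continuous_map (subtopology Z H) (subtopology C A) g"
      using continuous_map_from_subtopology_mono[OF g HG]
      by (auto simp: continuous_map_in_subtopology H_def)
    then have c: "continuous_map (subtopology Z H) Z (f \<circ> g)"
      using contf continuous_map_compose by blast
    have "z \<in> subtopology Z H closure_of ?S"
      using z G(3) HG SH by (auto simp: closure_of_subtopology Int_absorb1)
    then have "(f \<circ> g) z = id z"
      by (rule forall_in_closure_of_eq[OF _ _ c])
         (use gk kf metrizable_imp_Hausdorff_space[OF mZ] in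
            \<open>auto simp: continuous_map_from_subtopology\<close>)
    then show "z \<in> ?S"
      using z by (auto simp: H_def intro!: image_eqI[of _ _ "g z"])
  qed
  ultimately have S: "?S = H" by blast
  \<comment> \<open>At first this holds only relative to \<open>G\<close>. As \<open>G\<close> is
    G_delta in \<open>Z\<close>, intersecting with it stays within the F_sigma-delta sets of
    \<open>Z\<close>.\<close>
  have "fsigmadelta_in (subtopology Z G) H"
    unfolding H_def by (rule fsigmadelta_in_continuous_map_preimage[OF g A])
  then obtain T where T: "fsigmadelta_in Z T" "H = T \<inter> G"
    by (rule fsigmadelta_in_subtopology)
  then show "fsigmadelta_in Z (f ` topspace (subtopology C A))"
    using fsigmadelta_in_Int[OF T(1) gdelta_imp_fsigmadelta_in[OF mZ G(1)]] S tA by simp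
qed

section \<open>The space $\ell^2$\<close>

lemma l2_iff_summable: "x \<in> l2 \<longleftrightarrow> summable (\<lambda>n. (x n)\<^sup>2)"
  unfolding l2_def by (simp add: summable_on_UNIV_nonneg_real_iff)

lemma l2_norm_sums:
  assumes "x \<in> l2" shows "(\<lambda>n. (x n)\<^sup>2) sums (l2_norm x)\<^sup>2"
proof -
  have "((\<lambda>n. (x n)\<^sup>2) has_sum (\<Sum>\<^sub>\<infinity>n. (x n)\<^sup>2)) UNIV"
    using assms by (simp add: l2_def)
  then show ?thesis
    by (simp add: has_sum_imp_sums l2_norm_def infsum_nonneg)
qed

lemma sum_le_l2_norm:
  assumes "x \<in> l2" shows "(\<Sum>i<n. (x i)\<^sup>2) \<le> (l2_norm x)\<^sup>2"
  using l2_norm_sums[OF assms] by (metis sum_le_suminf sums_iff finite_lessThan zero_le_power2)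

text \<open>A norm bound is a family of closed conditions, each on finitely many coordinates. Hence
  it survives coordinatewise limits, and it yields membership in \<open>l2\<close> at the same
  time.\<close>

lemma l2_norm_le_iff:
  assumes "0 \<le> r"
  shows "x \<in> l2 \<and> l2_norm x \<le> r \<longleftrightarrow> (\<forall>n. (\<Sum>i<n. (x i)\<^sup>2) \<le> r\<^sup>2)"
proof
  assume "x \<in> l2 \<and> l2_norm x \<le> r"
  then show "\<forall>n. (\<Sum>i<n. (x i)\<^sup>2) \<le> r\<^sup>2"
    using sum_le_l2_norm l2_norm_nonneg by (meson order_trans power_mono)
next
  assume *: "\<forall>n. (\<Sum>i<n. (x i)\<^sup>2) \<le> r\<^sup>2"
  then have s: "summable (\<lambda>i. (x i)\<^sup>2)"
    by (intro summableI_nonneg_bounded[where x="r\<^sup>2"]) auto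
  then have "x \<in> l2" by (simp add: l2_iff_summable)
  moreover have "(l2_norm x)\<^sup>2 \<le> r\<^sup>2"
    using l2_norm_sums[OF \<open>x \<in> l2\<close>] suminf_le_const[OF s, of "r\<^sup>2"] * by (simp add: sums_iff)
  then have "l2_norm x \<le> r"
    using assms power2_le_imp_le by blast
  ultimately show "x \<in> l2 \<and> l2_norm x \<le> r" by blast
qed

lemma zero_in_l2: "(\<lambda>_. 0) \<in> l2"
  by (simp add: l2_def)

lemma l2_norm_eq_dist: "l2_norm x = l2_dist x (\<lambda>_. 0)"
  by (simp add: l2_dist_def)

lemma l2_add:
  assumes "x \<in> l2" "y \<in> l2" shows "(\<lambda>n. x n + y n) \<in> l2"
  using l2_diff[OF assms(1) l2_diff[OF zero_in_l2 assms(2)]] by simp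

lemma abs_le_l2_norm:
  assumes "x \<in> l2" shows "\<bar>x n\<bar> \<le> l2_norm x"
  using L2_set_le_l2_norm[OF assms, of "{n}"] by simp

interpretation L2: Metric_space l2 l2_dist
  rewrites "Metric_space.mtopology l2 l2_dist = l2_topology"
  by (auto simp: Metric_space_l2 l2_topology_def)

lemma l2_norm_triangle:
  assumes "x \<in> l2" "y \<in> l2" shows "\<bar>l2_norm x - l2_norm y\<bar> \<le> l2_dist x y"
  using L2.triangle[OF assms zero_in_l2] L2.triangle[OF assms(2,1) zero_in_l2]
  by (simp add: l2_norm_eq_dist L2.commute[of y x])

text \<open>The limit is formed coordinatewise, and the Cauchy bounds pass to it on every finite
  partial sum. The bound for 1 already puts the difference from some \<open>\<sigma> N\<close>, and
  so the limit itself, into \<open>l2\<close>.\<close>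

lemma mcomplete_l2: "L2.mcomplete"
  unfolding L2.mcomplete_def
proof (intro allI impI)
  fix \<sigma> assume "L2.MCauchy \<sigma>"
  then have \<sigma>: "\<And>n. \<sigma> n \<in> l2"
    and cau: "\<And>\<epsilon>. \<epsilon> > 0 \<Longrightarrow> \<exists>N. \<forall>m n. N \<le> m \<longrightarrow> N \<le> n \<longrightarrow> l2_dist (\<sigma> m) (\<sigma> n) < \<epsilon>"
    by (auto simp: L2.MCauchy_def)
  have "Cauchy (\<lambda>n. \<sigma> n i)" for i
  proof (rule CauchyI)
    fix \<epsilon> :: real assume "\<epsilon> > 0"
    then obtain N where "\<forall>m n. N \<le> m \<longrightarrow> N \<le> n \<longrightarrow> l2_dist (\<sigma> m) (\<sigma> n) < \<epsilon>"
      using cau by blast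
    moreover have "\<bar>\<sigma> m i - \<sigma> n i\<bar> \<le> l2_dist (\<sigma> m) (\<sigma> n)" for m n
      unfolding l2_dist_def using abs_le_l2_norm[OF l2_diff[OF \<sigma> \<sigma>]] by blast
    ultimately show "\<exists>M. \<forall>m\<ge>M. \<forall>n\<ge>M. norm (\<sigma> m i - \<sigma> n i) < \<epsilon>"
      by (metis order_le_less_trans real_norm_def)
  qed
  then have "\<forall>i. \<exists>l. (\<lambda>n. \<sigma> n i) \<longlonglongrightarrow> l"
    by (simp add: Cauchy_convergent_iff convergent_def)
  then obtain x where x: "\<And>i. (\<lambda>n. \<sigma> n i) \<longlonglongrightarrow> x i"
    by metis
  have est: "(\<lambda>i. \<sigma> n i - x i) \<in> l2 \<and> l2_dist (\<sigma> n) x \<le> \<epsilon>"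
    if "\<epsilon> > 0" and N: "\<forall>m n. N \<le> m \<longrightarrow> N \<le> n \<longrightarrow> l2_dist (\<sigma> m) (\<sigma> n) < \<epsilon>" and "n \<ge> N" for \<epsilon> n N
    unfolding l2_dist_def
  proof (subst l2_norm_le_iff)
    show "\<forall>k. (\<Sum>i<k. (\<sigma> n i - x i)\<^sup>2) \<le> \<epsilon>\<^sup>2"
    proof
      fix k
      have "(\<lambda>m. \<Sum>i<k. (\<sigma> n i - \<sigma> m i)\<^sup>2) \<longlonglongrightarrow> (\<Sum>i<k. (\<sigma> n i - x i)\<^sup>2)"
        by (intro tendsto_intros x)
      moreover have "(\<Sum>i<k. (\<sigma> n i - \<sigma> m i)\<^sup>2) \<le> \<epsilon>\<^sup>2" if "m \<ge> N" for m
        using N \<open>n \<ge> N\<close> that l2_diff[OF \<sigma> \<sigma>] l2_norm_le_iff[of \<epsilon> "\<lambda>i. \<sigma> n i - \<sigma> m i"] \<open>\<epsilon> > 0\<close>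
        by (auto simp: l2_dist_def less_imp_le)
      ultimately show "(\<Sum>i<k. (\<sigma> n i - x i)\<^sup>2) \<le> \<epsilon>\<^sup>2"
        by (intro LIMSEQ_le_const2) auto
    qed
  qed (use \<open>\<epsilon> > 0\<close> in auto)
  obtain N where "\<forall>m n. N \<le> m \<longrightarrow> N \<le> n \<longrightarrow> l2_dist (\<sigma> m) (\<sigma> n) < 1"
    using cau[of 1] by auto
  then have "(\<lambda>i. \<sigma> N i - x i) \<in> l2"
    using est[of 1 N N] by simp
  then have "x \<in> l2"
    using l2_diff[OF \<sigma>[of N]] by fastforce
  moreover have "\<exists>N. \<forall>n\<ge>N. \<sigma> n \<in> l2 \<and> l2_dist (\<sigma> n) x < \<epsilon>" if "\<epsilon> > 0" for \<epsilon>
  proof -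
    obtain N where "\<forall>m n. N \<le> m \<longrightarrow> N \<le> n \<longrightarrow> l2_dist (\<sigma> m) (\<sigma> n) < \<epsilon>/2"
      using cau[of "\<epsilon>/2"] \<open>\<epsilon> > 0\<close> by auto
    then have "\<forall>n\<ge>N. l2_dist (\<sigma> n) x \<le> \<epsilon>/2"
      using est[of "\<epsilon>/2"] \<open>\<epsilon> > 0\<close> by auto
    then show ?thesis
      using \<sigma> \<open>\<epsilon> > 0\<close> by (intro exI[of _ N]) force
  qed
  ultimately show "\<exists>x. limitin l2_topology \<sigma> x sequentially"
    unfolding L2.limit_metric_sequentially by blast
qed

lemma completely_metrizable_l2: "completely_metrizable_space l2_topology"
  using L2.completely_metrizable_space_mtopology mcomplete_l2 by blast

lemma metrizable_l2: "metrizable_space l2_topology"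
  using L2.metrizable_space_mtopology by simp

lemma continuous_map_l2_real:
  assumes "\<And>x y. x \<in> l2 \<Longrightarrow> y \<in> l2 \<Longrightarrow> \<bar>f x - f y\<bar> \<le> l2_dist x y"
  shows "continuous_map l2_topology euclideanreal f"
  unfolding continuous_map_def
proof (intro conjI allI impI)
  fix U :: "real set" assume "openin euclideanreal U"
  then have U: "open U" by simp
  show "openin l2_topology {x \<in> topspace l2_topology. f x \<in> U}"
    unfolding L2.openin_mtopology
  proof (intro conjI allI impI)
    fix x assume x: "x \<in> {x \<in> topspace l2_topology. f x \<in> U}"
    then obtain r where "r > 0" and r: "\<And>t. \<bar>t - f x\<bar> < r \<Longrightarrow> t \<in> U"
      using U unfolding open_dist dist_real_def by auto
    have "L2.mball x r \<subseteq> {x \<in> topspace l2_topology. f x \<in> U}"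
    proof
      fix y assume "y \<in> L2.mball x r"
      then show "y \<in> {x \<in> topspace l2_topology. f x \<in> U}"
        using assms[of y x] by (auto intro!: r simp: L2.commute[of y x])
    qed
    then show "\<exists>r>0. L2.mball x r \<subseteq> {x \<in> topspace l2_topology. f x \<in> U}"
      using \<open>r > 0\<close> by blast
  qed auto
qed auto

lemma continuous_map_l2_norm: "continuous_map l2_topology euclideanreal l2_norm"
  by (intro continuous_map_l2_real l2_norm_triangle)

lemma continuous_map_l2_coordinate: "continuous_map l2_topology euclideanreal (\<lambda>x. x i)"
  using abs_le_l2_norm[OF l2_diff] by (intro continuous_map_l2_real) (auto simp: l2_dist_def)

section \<open>The norm topology against the weak one, which is \<open>euclidean\<close> on
  sequences\<close>

lemma continuous_map_l2_euclidean: "continuous_map l2_topology euclidean (\<lambda>x. x)"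
  using continuous_map_l2_coordinate
  by (simp add: euclidean_product_topology[symmetric] continuous_map_componentwise_UNIV)

lemma closed_l2_cball:
  assumes "a \<in> l2" shows "closed {x \<in> l2. l2_dist x a \<le> r}"
proof (cases "0 \<le> r")
  case True
  have "x \<in> l2 \<longleftrightarrow> (\<lambda>i. x i - a i) \<in> l2" for x
    using l2_diff[OF _ assms] l2_add[OF _ assms] by fastforce
  then have "{x \<in> l2. l2_dist x a \<le> r} = {x. \<forall>n. (\<Sum>i<n. (x i - a i)\<^sup>2) \<le> r\<^sup>2}"
    unfolding l2_dist_def l2_norm_le_iff[OF True, symmetric] by blast
  then show ?thesis
    by (simp only:) (intro closed_Collect_all closed_Collect_le continuous_intros; simp)
next
  case False
  then have "{x \<in> l2. l2_dist x a \<le> r} = {}"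
    by (auto simp: l2_dist_def) (meson l2_norm_nonneg order_trans)
  then show ?thesis by (metis closed_empty)
qed

text \<open>This is the Kadec-Klee property. Weak closeness controls a finite head of
  \<open>x - p\<close> and bounds the head of \<open>x\<close> from below; with the bound on the
  norm of \<open>x\<close> this leaves little for its tail.\<close>

lemma kadec_klee_l2:
  assumes p: "p \<in> l2" and "\<epsilon> > 0"
  obtains W \<delta> where "open W" "p \<in> W" "\<delta> > 0"
    "\<And>x. x \<in> l2 \<Longrightarrow> x \<in> W \<Longrightarrow> l2_norm x < l2_norm p + \<delta> \<Longrightarrow> l2_dist x p < \<epsilon>"
proof -
  define P where "P = (l2_norm p)\<^sup>2"
  \<comment> \<open>The head of the difference contributes \<open>\<eta>\<close>, the tail of
    \<open>x\<close> at most twice \<open>3 * \<eta>\<close> and the tail of \<open>p\<close> at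
    most twice \<open>\<eta>\<close>. Together this is \<open>9 * \<eta>\<close>, the square of
    \<open>\<epsilon>/2\<close>.\<close>
  define \<eta> where "\<eta> = \<epsilon>\<^sup>2 / 36"
  have "\<eta> > 0" using \<open>\<epsilon> > 0\<close> by (simp add: \<eta>_def)
  have "(\<lambda>n. \<Sum>i<n. (p i)\<^sup>2) \<longlonglongrightarrow> P"
    using l2_norm_sums[OF p] by (simp add: sums_def P_def)
  then have "\<forall>\<^sub>F n in sequentially. (\<Sum>i<n. (p i)\<^sup>2) > P - \<eta>"
    using \<open>\<eta> > 0\<close> by (intro order_tendstoD) auto
  then obtain n where n: "(\<Sum>i<n. (p i)\<^sup>2) > P - \<eta>"
    by (auto simp: eventually_sequentially)
  define W where "W = {x. (\<Sum>i<n. (x i)\<^sup>2) > (\<Sum>i<n. (p i)\<^sup>2) - \<eta>} \<inter> {x. (\<Sum>i<n. (x i - p i)\<^sup>2) < \<eta>}"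
  define \<delta> where "\<delta> = sqrt (P + \<eta>) - l2_norm p"
  show thesis
  proof
    show "open W"
      unfolding W_def by (intro open_Int open_Collect_less continuous_intros) auto
    show "p \<in> W" using \<open>\<eta> > 0\<close> by (simp add: W_def)
    show "\<delta> > 0"
      using \<open>\<eta> > 0\<close> by (simp add: \<delta>_def P_def real_less_rsqrt)
    fix x assume x: "x \<in> l2" "x \<in> W" "l2_norm x < l2_norm p + \<delta>"
    then have "(l2_norm x)\<^sup>2 < (sqrt (P + \<eta>))\<^sup>2"
      by (intro power_strict_mono) (auto simp: \<delta>_def l2_norm_nonneg)
    then have nx: "(l2_norm x)\<^sup>2 < P + \<eta>"
      using \<open>\<eta> > 0\<close> by (simp add: P_def)
    have "(\<Sum>i<N. (x i - p i)\<^sup>2) \<le> (\<epsilon>/2)\<^sup>2" for N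
    proof -
      have split: "(\<Sum>i<n+N. f i) = (\<Sum>i<n. f i) + (\<Sum>i=n..<n+N. f i)" for f :: "nat \<Rightarrow> real"
        using sum.atLeastLessThan_concat[of 0 n "n+N" f] by (simp add: atLeast0LessThan)
      have "(\<Sum>i<N. (x i - p i)\<^sup>2) \<le> (\<Sum>i<n+N. (x i - p i)\<^sup>2)"
        by (rule sum_mono2) auto
      also have "\<dots> = (\<Sum>i<n. (x i - p i)\<^sup>2) + (\<Sum>i=n..<n+N. (x i - p i)\<^sup>2)"
        by (rule split)
      also have "(\<Sum>i=n..<n+N. (x i - p i)\<^sup>2) \<le> (\<Sum>i=n..<n+N. 2 * (x i)\<^sup>2 + 2 * (p i)\<^sup>2)"
      proof (rule sum_mono)
        show "(x i - p i)\<^sup>2 \<le> 2 * (x i)\<^sup>2 + 2 * (p i)\<^sup>2" for i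
          using zero_le_power2[of "x i + p i"] by (simp add: power2_eq_square algebra_simps)
      qed
      also have "\<dots> = 2 * (\<Sum>i=n..<n+N. (x i)\<^sup>2) + 2 * (\<Sum>i=n..<n+N. (p i)\<^sup>2)"
        by (simp add: sum.distrib sum_distrib_left)
      finally show ?thesis
        using split[of "\<lambda>i. (x i)\<^sup>2"] split[of "\<lambda>i. (p i)\<^sup>2"] n nx x(2)
          sum_le_l2_norm[OF x(1), of "n+N"] sum_le_l2_norm[OF p, of "n+N"]
        by (simp add: W_def P_def[symmetric] power_divide \<eta>_def)
    qed
    then have "l2_dist x p \<le> \<epsilon>/2"
      using l2_norm_le_iff[of "\<epsilon>/2" "\<lambda>i. x i - p i"] \<open>\<epsilon> > 0\<close> by (simp add: l2_dist_def)
    then show "l2_dist x p < \<epsilon>" using \<open>\<epsilon> > 0\<close> by simp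
  qed
qed

text \<open>The base consists of the sets \<open>W \<inter> {x \<in> l2. l2_norm x < s}\<close> with
  \<open>W\<close> from a countable weak base and \<open>s\<close> rational. They form a base by the
  Kadec-Klee property, and they are weakly F_sigma because an open ball about 0 is a countable union
  of closed balls, which are weakly closed.\<close>

lemma l2_countable_fsigma_base:
  obtains \<B> where "countable \<B>"
    "\<And>B. B \<in> \<B> \<Longrightarrow> openin l2_topology B" "\<And>B. B \<in> \<B> \<Longrightarrow> fsigma_in euclidean B"
    "\<And>U x. openin l2_topology U \<Longrightarrow> x \<in> U \<Longrightarrow> \<exists>B\<in>\<B>. x \<in> B \<and> B \<subseteq> U"
proof -
  obtain \<W> :: "(nat \<Rightarrow> real) set set" where W: "countable \<W>" "topological_basis \<W>"
    using ex_countable_basis by blast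
  define S where "S W s = W \<inter> {x \<in> l2. l2_norm x < s}" for W s
  show thesis
  proof
    show "countable ((\<lambda>(W, s). S W s) ` (\<W> \<times> \<rat>))"
      using W(1) countable_rat by (intro countable_image countable_SIGMA)
  next
    fix B assume "B \<in> (\<lambda>(W, s). S W s) ` (\<W> \<times> \<rat>)"
    then obtain W s where B: "B = S W s" and "W \<in> \<W>" by auto
    then have oW: "open W" using W(2) topological_basis_open by blast
    have "B = {x \<in> topspace l2_topology. x \<in> W} \<inter> {x \<in> topspace l2_topology. l2_norm x \<in> {..<s}}"
      by (auto simp: B S_def)
    moreover have "openin l2_topology \<dots>"
      using oW by (intro openin_Int openin_continuous_map_preimage[OF continuous_map_l2_euclidean]
          openin_continuous_map_preimage[OF continuous_map_l2_norm]) auto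
    ultimately show "openin l2_topology B" by simp
    have "l2_norm x < s \<longleftrightarrow> (\<exists>n. l2_norm x \<le> s - 1 / real (Suc n))" for x
    proof
      assume "l2_norm x < s"
      then obtain n where "1 / real (Suc n) < s - l2_norm x"
        using nat_approx_posE[of "s - l2_norm x"] by auto
      then show "\<exists>n. l2_norm x \<le> s - 1 / real (Suc n)"
        by (intro exI[of _ n]) simp
    next
      assume "\<exists>n. l2_norm x \<le> s - 1 / real (Suc n)"
      then obtain n where "l2_norm x \<le> s - 1 / real (Suc n)" ..
      moreover have "1 / real (Suc n) > 0" by simp
      ultimately show "l2_norm x < s" by linarith
    qed
    then have "B = W \<inter> \<Union> (range (\<lambda>n. {x \<in> l2. l2_norm x \<le> s - 1 / real (Suc n)}))"
      by (auto simp: B S_def)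
    moreover have "fsigma_in euclidean \<dots>"
    proof (intro fsigma_in_Int fsigma_in_Union)
      show "fsigma_in euclidean W"
        using oW by (simp add: open_imp_fsigma_in metrizable_space_euclidean)
    qed (use closed_l2_cball[OF zero_in_l2] in \<open>auto intro!: closed_imp_fsigma_in simp: l2_norm_eq_dist\<close>)
    ultimately show "fsigma_in euclidean B" by simp
  next
    fix U x assume U: "openin l2_topology U" and "x \<in> U"
    then have x: "x \<in> l2" using openin_subset by fastforce
    obtain r where "r > 0" "L2.mball x r \<subseteq> U"
      using U \<open>x \<in> U\<close> unfolding L2.openin_mtopology by blast
    obtain W \<delta> where Wd: "open W" "x \<in> W" "\<delta> > 0"
      "\<And>y. y \<in> l2 \<Longrightarrow> y \<in> W \<Longrightarrow> l2_norm y < l2_norm x + \<delta> \<Longrightarrow> l2_dist y x < r"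
      using kadec_klee_l2[OF x \<open>r > 0\<close>] by blast
    obtain W' where W': "W' \<in> \<W>" "x \<in> W'" "W' \<subseteq> W"
      using W(2) Wd topological_basisE by metis
    obtain s where s: "s \<in> \<rat>" "l2_norm x < s" "s < l2_norm x + \<delta>"
      using Rats_dense_in_real[of "l2_norm x" "l2_norm x + \<delta>"] Wd by auto
    have "S W' s \<subseteq> L2.mball x r"
      using Wd(4) W' s x L2.commute by (fastforce simp: S_def)
    then show "\<exists>B\<in>(\<lambda>(W, s). S W s) ` (\<W> \<times> \<rat>). x \<in> B \<and> B \<subseteq> U"
      using W' s x \<open>L2.mball x r \<subseteq> U\<close> by (intro bexI[of _ "S W' s"]) (auto simp: S_def)
  qed
qed

lemma second_countable_l2: "second_countable l2_topology"
  using l2_countable_fsigma_base unfolding second_countable_def by metis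

lemma fsigma_l2_open:
  assumes "openin l2_topology U" shows "fsigma_in euclidean U"
proof -
  obtain \<B> where \<B>: "countable \<B>" "\<And>B. B \<in> \<B> \<Longrightarrow> fsigma_in euclidean B"
    "\<And>U x. openin l2_topology U \<Longrightarrow> x \<in> U \<Longrightarrow> \<exists>B\<in>\<B>. x \<in> B \<and> B \<subseteq> U"
    using l2_countable_fsigma_base by metis
  have "U = \<Union> {B \<in> \<B>. B \<subseteq> U}"
    using \<B>(3)[OF assms] by blast
  moreover have "fsigma_in euclidean (\<Union> {B \<in> \<B>. B \<subseteq> U})"
    using \<B> by (intro fsigma_in_Union) auto
  ultimately show ?thesis by simp
qed

lemma fsigma_in_euclidean_Times:
  assumes "fsigma_in euclidean A" "fsigma_in euclidean B"
  shows "fsigma_in euclidean (A \<times> B)"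
proof -
  have "A \<times> B = {z \<in> topspace euclidean. fst z \<in> A} \<inter> {z \<in> topspace euclidean. snd z \<in> B}"
    by auto
  moreover have "fsigma_in euclidean \<dots>"
    using assms by (intro fsigma_in_Int fsigma_in_continuous_map_preimage[where Y=euclidean])
      (auto simp: continuous_on_fst continuous_on_snd)
  ultimately show ?thesis by simp
qed

text \<open>Products of two members of the countable base are weakly F_sigma, and an open set is the
  union of the countably many that it contains.\<close>

lemma fsigma_l2_prod_open:
  assumes "openin (prod_topology l2_topology l2_topology) U"
  shows "fsigma_in euclidean U"
proof -
  obtain \<B> where \<B>: "countable \<B>" "\<And>B. B \<in> \<B> \<Longrightarrow> fsigma_in euclidean B"
    "\<And>U x. openin l2_topology U \<Longrightarrow> x \<in> U \<Longrightarrow> \<exists>B\<in>\<B>. x \<in> B \<and> B \<subseteq> U"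
    using l2_countable_fsigma_base by metis
  let ?\<C> = "{C \<in> (\<lambda>(A, B). A \<times> B) ` (\<B> \<times> \<B>). C \<subseteq> U}"
  have "z \<in> \<Union> ?\<C>" if zU: "z \<in> U" for z
  proof -
    obtain x y where z: "z = (x, y)" by (cases z)
    obtain V W where VW: "openin l2_topology V" "openin l2_topology W" "x \<in> V" "y \<in> W" "V \<times> W \<subseteq> U"
      using assms[unfolded openin_prod_topology_alt, rule_format, OF zU[unfolded z]] by blast
    obtain A where A: "A \<in> \<B>" "x \<in> A" "A \<subseteq> V"
      using \<B>(3)[OF VW(1,3)] by blast
    obtain B where B: "B \<in> \<B>" "y \<in> B" "B \<subseteq> W"
      using \<B>(3)[OF VW(2,4)] by blast
    have "A \<times> B \<subseteq> U" using VW(5) A(3) B(3) by blast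
    then show ?thesis
      unfolding z using A B by (intro UnionI[of "A \<times> B"]) auto
  qed
  then have "U = \<Union> ?\<C>" by blast
  moreover have "fsigma_in euclidean (\<Union> ?\<C>)"
  proof (rule fsigma_in_Union)
    have "countable ((\<lambda>(A, B). A \<times> B) ` (\<B> \<times> \<B>))"
      using \<B>(1) by (intro countable_image countable_SIGMA)
    then show "countable ?\<C>"
      by (rule countable_subset[rotated]) auto
  qed (use \<B>(2) in \<open>auto intro: fsigma_in_euclidean_Times\<close>)
  ultimately show ?thesis by simp
qed

lemma sm_space_l2_subtopology:
  assumes "S \<subseteq> l2" "S \<noteq> {}"
  shows "sm_space (subtopology l2_topology S)"
proof -
  have "separable_space (subtopology l2_topology S)"
    by (intro second_countable_imp_separable_space second_countable_subtopology second_countable_l2)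
  then show ?thesis
    unfolding sm_space_def using assms metrizable_l2 metrizable_space_subtopology by auto
qed

section \<open>Clopen sets and almost zero-dimensionality\<close>

text \<open>An interval with end points in \<open>D\<close> has the same preimage as its closure,
  because the coordinates of \<open>e\<close> avoid \<open>D\<close>; so the preimage is clopen. A
  basic open set of the product restricts only finitely many coordinates. With \<open>D\<close> the
  rationals this serves irrational coordinates, with \<open>D\<close> the irrationals rational
  ones.\<close>

lemma clopen_nbhd_of_product_open:
  fixes e :: "'a \<Rightarrow> nat \<Rightarrow> real"
  assumes e: "continuous_map X euclidean e"
    and D: "\<And>a b. a < b \<Longrightarrow> \<exists>d\<in>D. a < d \<and> d < b"
    and avoid: "\<And>x i. x \<in> topspace X \<Longrightarrow> e x i \<notin> D"
    and U: "open U" "x \<in> topspace X" "e x \<in> U"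
  obtains C where "openin X C" "closedin X C" "x \<in> C" "e ` C \<subseteq> U"
proof -
  obtain V where V: "e x \<in> Pi\<^sub>E UNIV V" "\<And>i. open (V i)" "finite {i. V i \<noteq> UNIV}" "Pi\<^sub>E UNIV V \<subseteq> U"
    using product_topology_open_contains_basis[of "\<lambda>_. euclidean" UNIV U "e x"] U
    by (auto simp: euclidean_product_topology)
  have coord: "continuous_map X euclideanreal (\<lambda>y. e y i)" for i
    using e by (simp add: euclidean_product_topology[symmetric] continuous_map_componentwise_UNIV)
  have "\<exists>a b. a \<in> D \<and> b \<in> D \<and> e x i \<in> {a<..<b} \<and> {a<..<b} \<subseteq> V i" for i
  proof -
    have "e x i \<in> V i" using V(1) by auto
    then obtain r where "r > 0" and r: "\<And>t. \<bar>t - e x i\<bar> < r \<Longrightarrow> t \<in> V i"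
      using V(2)[of i] unfolding open_dist dist_real_def by metis
    obtain a where "a \<in> D" "e x i - r < a" "a < e x i"
      using D[of "e x i - r" "e x i"] \<open>r > 0\<close> by auto
    moreover obtain b where "b \<in> D" "e x i < b" "b < e x i + r"
      using D[of "e x i" "e x i + r"] \<open>r > 0\<close> by auto
    ultimately show ?thesis
      by (intro exI[of _ a] exI[of _ b]) (auto intro!: r)
  qed
  then obtain a b where ab: "\<And>i. a i \<in> D" "\<And>i. b i \<in> D" "\<And>i. e x i \<in> {a i<..<b i}" "\<And>i. {a i<..<b i} \<subseteq> V i"
    by metis
  define C where "C i = {y \<in> topspace X. e y i \<in> {a i<..<b i}}" for i
  have C1: "openin X (C i)" for i
    unfolding C_def by (rule openin_continuous_map_preimage[OF coord]) simp
  have "e y i \<in> {a i<..<b i} \<longleftrightarrow> e y i \<in> {a i..b i}" if "y \<in> topspace X" for y i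
    using avoid[OF that, of i] ab(1,2)[of i] by (auto simp: less_le)
  then have "C i = {y \<in> topspace X. e y i \<in> {a i..b i}}" for i
    by (auto simp only: C_def)
  then have C2: "closedin X (C i)" for i
    using closedin_continuous_map_preimage[OF coord, of "{a i..b i}"] by simp
  let ?J = "{i. V i \<noteq> UNIV}"
  \<comment> \<open>Rewritten as the intersection of a nonempty family, which also covers the case
    that no coordinate is restricted.\<close>
  have I: "topspace X \<inter> \<Inter> (C ` ?J) = \<Inter> (insert (topspace X) (C ` ?J))" by auto
  have "openin X (topspace X \<inter> \<Inter> (C ` ?J))"
    unfolding I using C1 V(3) by (intro openin_Inter) auto
  moreover have "closedin X (topspace X \<inter> \<Inter> (C ` ?J))"
    unfolding I using C2 by (intro closedin_Inter) auto
  moreover have "x \<in> topspace X \<inter> \<Inter> (C ` ?J)"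
    using U ab by (auto simp: C_def)
  moreover have "e ` (topspace X \<inter> \<Inter> (C ` ?J)) \<subseteq> U"
  proof clarify
    fix y assume y: "y \<in> topspace X" "y \<in> \<Inter> (C ` ?J)"
    have "e y i \<in> V i" for i
    proof (cases "V i = UNIV")
      case False
      then have "y \<in> C i" using y(2) by blast
      then show ?thesis using ab(4)[of i] by (auto simp: C_def)
    qed simp
    then show "e y \<in> U" using V(4) by auto
  qed
  ultimately show thesis using that by blast
qed

lemma sqrt_2_irrational: "sqrt 2 \<notin> \<rat>"
proof
  assume "sqrt 2 \<in> \<rat>"
  then obtain m n :: nat where n: "n \<noteq> 0" and mn: "\<bar>sqrt 2\<bar> = m / n" and cop: "coprime m n"
    by (rule Rats_abs_nat_div_natE)
  have "real m = \<bar>sqrt 2\<bar> * n" using n mn by simp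
  then have "(real m)\<^sup>2 = 2 * (real n)\<^sup>2" by (simp add: power_mult_distrib)
  then have eq: "m\<^sup>2 = 2 * n\<^sup>2" using of_nat_eq_iff[where 'a=real] by fastforce
  then have "even (m\<^sup>2)" by simp
  then have "even m" by simp
  then obtain k where "m = 2 * k" by blast
  with eq have "n\<^sup>2 = 2 * k\<^sup>2" by (simp add: power_mult_distrib)
  then have "even (n\<^sup>2)" by simp
  then have "even n" by simp
  with \<open>even m\<close> cop show False by auto
qed

lemma Rats_plus_irrational: "q \<in> \<rat> \<Longrightarrow> q + sqrt 2 \<notin> \<rat>"
proof
  assume "q \<in> \<rat>" "q + sqrt 2 \<in> \<rat>"
  then have "(q + sqrt 2) - q \<in> \<rat>" by (rule Rats_diff[rotated])
  then show False using sqrt_2_irrational by simp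
qed

lemma E_prime_subset_E_c: "E_prime \<subseteq> E_c"
proof
  fix x assume x: "x \<in> E_prime"
  have "x n \<notin> \<rat>" for n
    using x Rats_plus_irrational by (auto simp: E_prime_def dest!: spec[of _ n])
  then show "x \<in> E_c" using x by (auto simp: E_prime_def E_c_def)
qed

text \<open>Coordinate \<open>i\<close> is moved by less than
  \<open>(\<epsilon>/2) * (1/2)^Suc i\<close>, so the squares of the changes add up to at most the
  square of \<open>\<epsilon>/2\<close>.\<close>

lemma E_prime_dense:
  assumes x: "x \<in> l2" and "\<epsilon> > 0"
  obtains y where "y \<in> E_prime" "l2_dist y x < \<epsilon>"
proof -
  have "\<exists>y. y \<in> (\<lambda>q. q + sqrt 2) ` \<rat> \<and> \<bar>y - x i\<bar> < (\<epsilon>/2) * (1/2)^Suc i" for i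
  proof -
    have "(0::real) < (\<epsilon>/2) * (1/2)^Suc i" using \<open>\<epsilon> > 0\<close> by simp
    then have "x i - sqrt 2 < x i - sqrt 2 + (\<epsilon>/2) * (1/2)^Suc i" by linarith
    then obtain q where q: "q \<in> \<rat>" "x i - sqrt 2 < q" "q < x i - sqrt 2 + (\<epsilon>/2) * (1/2)^Suc i"
      using Rats_dense_in_real by blast
    then have "\<bar>q + sqrt 2 - x i\<bar> < (\<epsilon>/2) * (1/2)^Suc i" by linarith
    then show ?thesis using q(1) by blast
  qed
  then obtain y where y: "\<And>i. y i \<in> (\<lambda>q. q + sqrt 2) ` \<rat>" "\<And>i. \<bar>y i - x i\<bar> < (\<epsilon>/2) * (1/2)^Suc i"
    by metis
  have geo: "(\<Sum>i<n. (1/2::real)^Suc i) = 1 - (1/2)^n" for n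
    by (induction n) auto
  have "(\<Sum>i<n. (y i - x i)\<^sup>2) \<le> (\<epsilon>/2)\<^sup>2" for n
  proof -
    have "(y i - x i)\<^sup>2 \<le> (\<epsilon>/2)\<^sup>2 * (1/2)^Suc i" for i
    proof -
      have "\<bar>y i - x i\<bar>\<^sup>2 \<le> ((\<epsilon>/2) * (1/2)^Suc i)\<^sup>2"
        using y(2)[of i] by (intro power_mono) auto
      also have "\<dots> = (\<epsilon>/2)\<^sup>2 * ((1/2)^Suc i * (1/2)^Suc i)"
        by (simp add: power2_eq_square)
      also have "\<dots> \<le> (\<epsilon>/2)\<^sup>2 * (1 * (1/2)^Suc i)"
        by (intro mult_left_mono mult_right_mono power_le_one) auto
      finally show ?thesis by simp
    qed
    then have "(\<Sum>i<n. (y i - x i)\<^sup>2) \<le> (\<Sum>i<n. (\<epsilon>/2)\<^sup>2 * (1/2)^Suc i)"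
      by (intro sum_mono)
    also have "\<dots> = (\<epsilon>/2)\<^sup>2 * (1 - (1/2)^n)"
      by (simp only: sum_distrib_left[symmetric] geo)
    also have "\<dots> \<le> (\<epsilon>/2)\<^sup>2" by (simp add: mult_left_le)
    finally show ?thesis .
  qed
  then have d: "(\<lambda>i. y i - x i) \<in> l2" "l2_dist y x \<le> \<epsilon>/2"
    using l2_norm_le_iff[of "\<epsilon>/2" "\<lambda>i. y i - x i"] \<open>\<epsilon> > 0\<close> by (auto simp: l2_dist_def)
  then have "y \<in> l2" using l2_add[OF d(1) x] by simp
  then have "y \<in> E_prime"
    unfolding E_prime_def by (intro CollectI conjI allI y(1))
  then show thesis using d(2) \<open>\<epsilon> > 0\<close> by (intro that[of y]) auto
qed

text \<open>On irrational sequences the weak topology has a base of clopen sets, and closed norm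
  balls are weakly closed. Hence the trace of such a ball is the intersection of all its clopen
  supersets, and these traces are the required neighbourhoods.\<close>

lemma almost_zero_dimensional_subset_E_c:
  assumes S: "S \<subseteq> E_c" "S \<noteq> {}"
  shows "almost_zero_dimensional (subtopology l2_topology S)"
proof -
  define X where "X = subtopology l2_topology S"
  have Sl2: "S \<subseteq> l2" using S by (auto simp: E_c_def)
  then have tX: "topspace X = S" by (auto simp: X_def)
  have idc: "continuous_map X euclidean (\<lambda>x. x)"
    unfolding X_def by (intro continuous_map_from_subtopology continuous_map_l2_euclidean)
  have C: "C_set_in X (S \<inter> {y \<in> l2. l2_dist y x \<le> r})" if x: "x \<in> l2" for x r
  proof -
    let ?V = "S \<inter> {y \<in> l2. l2_dist y x \<le> r}"
    let ?\<U> = "{U. openin X U \<and> closedin X U \<and> ?V \<subseteq> U}"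
    have top: "topspace X \<in> ?\<U>"
      using openin_topspace[of X] closedin_topspace[of X] by (auto simp: tX)
    have "z \<in> ?V" if z: "z \<in> \<Inter> ?\<U>" for z
    proof (rule ccontr)
      assume "z \<notin> ?V"
      moreover have zS: "z \<in> topspace X" using z top by blast
      ultimately have z': "z \<in> - {y \<in> l2. l2_dist y x \<le> r}" using tX by blast
      have avoid: "y i \<notin> \<rat>" if "y \<in> topspace X" for y i
        using that S tX by (auto simp: E_c_def)
      have op: "open (- {y \<in> l2. l2_dist y x \<le> r})"
        using closed_l2_cball[OF x] by (rule open_Compl)
      obtain C where C: "openin X C" "closedin X C" "z \<in> C" "(\<lambda>x. x) ` C \<subseteq> - {y \<in> l2. l2_dist y x \<le> r}"
        by (rule clopen_nbhd_of_product_open[where e="\<lambda>x. x" and D=\<rat> and x=z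
              and U="- {y \<in> l2. l2_dist y x \<le> r}", OF idc Rats_dense_in_real _ op zS z'])
          (use avoid in blast)+
      then have "topspace X - C \<in> ?\<U>"
        using tX by (auto simp: openin_diff closedin_diff)
      with z C(3) show False by blast
    qed
    then have "?V = \<Inter> ?\<U>" by blast
    then show ?thesis
      unfolding C_set_in_def using top by (intro exI[of _ ?\<U>]) blast
  qed
  have "neighbourhood_base_of (C_set_in X) X"
    unfolding neighbourhood_base_of
  proof (intro allI impI, elim conjE)
    fix W x assume "openin X W" and xW: "x \<in> W"
    then obtain O' where O': "openin l2_topology O'" "W = O' \<inter> S"
      unfolding X_def openin_subtopology by blast
    then have "x \<in> O'" "x \<in> S" using xW by auto
    then obtain r where r: "r > 0" "L2.mball x r \<subseteq> O'"
      using O' unfolding L2.openin_mtopology by blast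
    have x: "x \<in> l2" using \<open>x \<in> S\<close> Sl2 by blast
    have "openin X (L2.mball x (r/2) \<inter> S)"
      unfolding X_def openin_subtopology using L2.openin_mball by blast
    moreover have "x \<in> L2.mball x (r/2) \<inter> S"
      using r x \<open>x \<in> S\<close> by simp
    moreover have "L2.mball x (r/2) \<inter> S \<subseteq> S \<inter> {y \<in> l2. l2_dist y x \<le> r/2}"
      using L2.commute by auto
    moreover have "S \<inter> {y \<in> l2. l2_dist y x \<le> r/2} \<subseteq> W"
      using r x O' by (auto simp: L2.commute subset_iff)
    ultimately show "\<exists>U V. openin X U \<and> C_set_in X V \<and> x \<in> U \<and> U \<subseteq> V \<and> V \<subseteq> W"
      using C[OF x] by blast
  qed
  then show ?thesis
    unfolding almost_zero_dimensional_def X_def using sm_space_l2_subtopology Sl2 S(2) by blast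
qed

section \<open>The Borel class of the space of the theorem\<close>

lemma fsigma_in_countable:
  assumes "countable S" "t1_space X" "S \<subseteq> topspace X"
  shows "fsigma_in X S"
proof -
  have "fsigma_in X (\<Union> ((\<lambda>x. {x}) ` S))"
    using assms by (intro fsigma_in_Union) (auto intro!: closed_imp_fsigma_in simp: closedin_t1_singleton)
  then show ?thesis by simp
qed

lemma fsigmadelta_in_countable_Compl:
  fixes S :: "real set"
  assumes "countable S" shows "fsigmadelta_in euclideanreal (- S)"
proof (rule gdelta_imp_fsigmadelta_in)
  show "gdelta_in euclideanreal (- S)"
    using assms by (simp add: gdelta_in_fsigma_in fsigma_in_countable t1_space_euclidean Diff_eq)
qed (simp add: metrizable_space_euclidean)

text \<open>The underlying set of the space of the theorem.\<close>

definition E_rat_norm :: "(nat \<Rightarrow> real) set" where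
  "E_rat_norm = E_prime \<union> {x \<in> E_c. l2_norm x \<in> \<rat>}"

text \<open>Membership is decided by whether coordinates and norm, all continuous, lie in countable
  sets, which are F_sigma, or in co-countable ones, which are G_delta.\<close>

lemma fsigmadelta_E_rat_norm: "fsigmadelta_in l2_topology E_rat_norm"
proof -
  have fsc: "fsigmadelta_in l2_topology {x \<in> topspace l2_topology. f x \<in> S}"
    if "continuous_map l2_topology euclideanreal f" "countable S" for f and S :: "real set"
    using that by (intro fsigmadelta_in_continuous_map_preimage[where Y=euclideanreal]
        fsigma_imp_fsigmadelta_in fsigma_in_countable) (auto simp: t1_space_euclidean)
  have "E_prime = (\<Inter>n. {x \<in> topspace l2_topology. x n \<in> (\<lambda>q. q + sqrt 2) ` \<rat>})"
    by (auto simp: E_prime_def)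
  moreover have "fsigmadelta_in l2_topology \<dots>"
    by (intro fsigmadelta_in_INT fsc continuous_map_l2_coordinate countable_image countable_rat)
  moreover have "{x \<in> E_c. l2_norm x \<in> \<rat>} = (\<Inter>n. {x \<in> topspace l2_topology. x n \<in> - \<rat>})
      \<inter> {x \<in> topspace l2_topology. l2_norm x \<in> \<rat>}"
    by (auto simp: E_c_def)
  moreover have "fsigmadelta_in l2_topology \<dots>"
    by (intro fsigmadelta_in_Int fsigmadelta_in_INT fsc continuous_map_l2_norm countable_rat
        fsigmadelta_in_continuous_map_preimage[OF continuous_map_l2_coordinate] fsigmadelta_in_countable_Compl)
  ultimately show ?thesis
    unfolding E_rat_norm_def by (simp add: fsigmadelta_in_Un)
qed

lemma E_rat_norm_subset_E_c: "E_rat_norm \<subseteq> E_c"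
  using E_prime_subset_E_c by (auto simp: E_rat_norm_def)

lemma E_rat_norm_nonempty: "E_rat_norm \<noteq> {}"
  using E_prime_dense[OF zero_in_l2, of 1] by (auto simp: E_rat_norm_def)

section \<open>The argument of Erdos\<close>

lemma l2_fun_upd:
  assumes "x \<in> l2" shows "x(n := t) \<in> l2"
proof -
  have "\<forall>\<^sub>F i in sequentially. ((x(n := t)) i)\<^sup>2 = (x i)\<^sup>2"
    by (intro eventually_sequentiallyI[of "Suc n"]) auto
  then show ?thesis
    using assms summable_cong unfolding l2_iff_summable by fast
qed

lemma l2_dist_fun_upd_le: "l2_dist (x(n := s)) (x(n := t)) \<le> \<bar>s - t\<bar>"
proof -
  have "(\<Sum>i<N. ((x(n := s)) i - (x(n := t)) i)\<^sup>2) \<le> \<bar>s - t\<bar>\<^sup>2" for N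
  proof -
    have "(\<Sum>i<N. ((x(n := s)) i - (x(n := t)) i)\<^sup>2) = (\<Sum>i<N. if i = n then (s - t)\<^sup>2 else 0)"
      by (intro sum.cong) auto
    then show ?thesis by simp
  qed
  then show ?thesis
    using l2_norm_le_iff[of "\<bar>s - t\<bar>" "\<lambda>i. (x(n := s)) i - (x(n := t)) i"] by (simp add: l2_dist_def)
qed

lemma E_prime_subset_l2: "E_prime \<subseteq> l2"
  by (auto simp: E_prime_def)

lemma E_prime_fun_upd:
  assumes "x \<in> E_prime" "r \<in> \<rat>"
  shows "x(n := x n + r) \<in> E_prime"
proof -
  have "x(n := x n + r) \<in> l2"
    using assms E_prime_subset_l2 l2_fun_upd by blast
  moreover obtain q where "q \<in> \<rat>" "x n = q + sqrt 2"
    using assms by (auto simp: E_prime_def dest: spec[of _ n])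
  then have "x n + r = (q + r) + sqrt 2" "q + r \<in> \<rat>"
    using assms(2) by auto
  then have "x n + r \<in> (\<lambda>q. q + sqrt 2) ` \<rat>" by blast
  ultimately show ?thesis
    using assms(1) unfolding E_prime_def by simp
qed

text \<open>Coordinate by coordinate, \<open>A (Suc n)\<close> pushes the \<open>n\<close>-th coordinate of \<open>A n\<close> almost as far as is
  possible within \<open>C\<close> and below norm \<open>q\<close>, and \<open>B n\<close> pushes it too far by at most \<open>1 / Suc n\<close>. Both
  sequences converge in norm to the same point of \<open>E_prime\<close>.\<close>

lemma erdos_argument:
  assumes S: "E_prime \<subseteq> S" "S \<subseteq> l2"
    and C: "openin (subtopology l2_topology S) C" "closedin (subtopology l2_topology S) C"
    and a: "a \<in> E_prime" "a \<in> C" "l2_norm a < q"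
  obtains b where "b \<in> E_prime" "b \<in> C" "l2_norm b = q"
proof -
  define G where "G = {x \<in> E_prime. x \<in> C \<and> l2_norm x < q}"
  have q: "q > 0" using a(3) l2_norm_nonneg le_less_trans by blast
  have step: "\<exists>y. (y \<in> G \<and> (\<forall>i\<ge>Suc n. y i = a i)) \<and>
      (\<exists>t t'. y = x(n := t) \<and> x(n := t') \<in> E_prime \<and> x(n := t') \<notin> G \<and> \<bar>t' - t\<bar> \<le> 1 / real (Suc n))"
    if x: "x \<in> G \<and> (\<forall>i\<ge>n. x i = a i)" for x n
  proof -
    \<comment> \<open>The step is rational, so that it preserves \<open>E_prime\<close>, and it
      tends to 0, so that the last point inside and the first point outside have a common
      limit.\<close>
    define s where "s = 1 / real (Suc n)"
    have "s > 0" "s \<in> \<rat>" by (auto simp: s_def)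
    define y where "y j = x(n := x n + real j * s)" for j
    have xE: "x \<in> E_prime" using x by (simp add: G_def)
    have yE: "y j \<in> E_prime" for j
      unfolding y_def using xE \<open>s \<in> \<rat>\<close> by (intro E_prime_fun_upd) auto
    \<comment> \<open>After this many steps the \<open>n\<close>-th coordinate alone exceeds
      \<open>q\<close>, so the walk leaves \<open>G\<close>.\<close>
    obtain j where j: "q + \<bar>x n\<bar> < real j * s"
      using ex_less_of_nat_mult \<open>s > 0\<close> by blast
    have "\<bar>y j n\<bar> \<le> l2_norm (y j)"
      using yE E_prime_subset_l2 abs_le_l2_norm by blast
    then have "q < l2_norm (y j)"
      using j by (simp add: y_def)
    then have "y j \<notin> G" by (simp add: G_def)
    moreover have "y 0 = x" by (simp add: y_def)
    then have "y 0 \<in> G" using x by simp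
    ultimately obtain k where k: "y k \<in> G" "y (Suc k) \<notin> G"
      using ex_least_nat_less[of "\<lambda>j. y j \<notin> G" j] by blast
    have "(x n + real (Suc k) * s) - (x n + real k * s) = s"
      by (simp add: algebra_simps)
    then have "\<bar>(x n + real (Suc k) * s) - (x n + real k * s)\<bar> \<le> 1 / real (Suc n)"
      using \<open>s > 0\<close> unfolding s_def[symmetric] by simp
    moreover have "\<forall>i\<ge>Suc n. y k i = a i" using x by (simp add: y_def)
    ultimately show ?thesis
      using k yE[of "Suc k"] unfolding y_def by blast
  qed
  have "\<exists>A. \<forall>n. (A n \<in> G \<and> (\<forall>i\<ge>n. A n i = a i)) \<and>
      (\<exists>t t'. A (Suc n) = (A n)(n := t) \<and> (A n)(n := t') \<in> E_prime \<and> (A n)(n := t') \<notin> G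
        \<and> \<bar>t' - t\<bar> \<le> 1 / real (Suc n))"
  proof (rule dependent_nat_choice)
    show "\<exists>x. x \<in> G \<and> (\<forall>i\<ge>0. x i = a i)"
      using a by (intro exI[of _ a]) (auto simp: G_def)
  qed (use step in blast)
  then obtain A where AG: "\<And>n. A n \<in> G" and Aa: "\<And>n i. i \<ge> n \<Longrightarrow> A n i = a i"
    and As: "\<And>n. \<exists>t t'. A (Suc n) = (A n)(n := t) \<and> (A n)(n := t') \<in> E_prime \<and> (A n)(n := t') \<notin> G
        \<and> \<bar>t' - t\<bar> \<le> 1 / real (Suc n)"
    by blast
  obtain T T' where T: "\<And>n. A (Suc n) = (A n)(n := T n)"
     "\<And>n. (A n)(n := T' n) \<in> E_prime" "\<And>n. (A n)(n := T' n) \<notin> G" "\<And>n. \<bar>T' n - T n\<bar> \<le> 1 / real (Suc n)"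
    using As by metis
  define B where "B n = (A n)(n := T' n)" for n
  have AE: "A n \<in> E_prime" and AC: "A n \<in> C" and Aq: "l2_norm (A n) < q" for n
    using AG[of n] by (auto simp: G_def)
  have Al2: "A n \<in> l2" and Bl2: "B n \<in> l2" for n
    using AE T(2) E_prime_subset_l2 by (auto simp: B_def)
  define b where "b i = A (Suc i) i" for i
  \<comment> \<open>Coordinate \<open>i\<close> is altered only in the passage from
    \<open>A i\<close> to \<open>A (Suc i)\<close>.\<close>
  have Ab: "A n i = b i" if "i < n" for n i
    using that by (induction n) (auto simp: T(1) less_Suc_eq b_def)
  have "(\<Sum>i<n. (b i)\<^sup>2) \<le> q\<^sup>2" for n
  proof -
    have "(\<Sum>i<n. (b i)\<^sup>2) = (\<Sum>i<n. (A n i)\<^sup>2)"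
      by (intro sum.cong) (auto simp: Ab)
    also have "\<dots> \<le> q\<^sup>2"
      using l2_norm_le_iff[of q "A n"] q Aq[of n] Al2 by auto
    finally show ?thesis .
  qed
  then have bl2: "b \<in> l2" and bq: "l2_norm b \<le> q"
    using l2_norm_le_iff[of q b] q by auto
  have "b n \<in> (\<lambda>q. q + sqrt 2) ` \<rat>" for n
    using AE[of "Suc n"] by (auto simp: b_def E_prime_def)
  then have bE: "b \<in> E_prime"
    using bl2 unfolding E_prime_def by blast
  define d where "d i = a i - b i" for i
  have dl2: "d \<in> l2"
    unfolding d_def using a(1) E_prime_subset_l2 bl2 by (intro l2_diff) auto
  \<comment> \<open>\<open>A n\<close> agrees with \<open>b\<close> below \<open>n\<close> and with
    \<open>a\<close> from \<open>n\<close> on, so its distance from \<open>b\<close> is the norm of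
    a tail of \<open>d\<close>.\<close>
  have Alim: "\<exists>N. \<forall>n\<ge>N. l2_dist (A n) b < \<epsilon>" if "\<epsilon> > 0" for \<epsilon>
  proof -
    have "(\<lambda>n. \<Sum>i<n. (d i)\<^sup>2) \<longlonglongrightarrow> (l2_norm d)\<^sup>2"
      using l2_norm_sums[OF dl2] by (simp add: sums_def)
    then have "\<forall>\<^sub>F n in sequentially. (\<Sum>i<n. (d i)\<^sup>2) > (l2_norm d)\<^sup>2 - (\<epsilon>/2)\<^sup>2"
      using \<open>\<epsilon> > 0\<close> by (intro order_tendstoD) auto
    then obtain N where N: "\<And>n. n \<ge> N \<Longrightarrow> (\<Sum>i<n. (d i)\<^sup>2) > (l2_norm d)\<^sup>2 - (\<epsilon>/2)\<^sup>2"
      by (auto simp: eventually_sequentially)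
    have "l2_dist (A n) b \<le> \<epsilon>/2" if "n \<ge> N" for n
    proof -
      have "(\<Sum>i<m. (A n i - b i)\<^sup>2) \<le> (\<epsilon>/2)\<^sup>2" for m
      proof -
        have "(\<Sum>i<m. (A n i - b i)\<^sup>2) \<le> (\<Sum>i<n+m. (A n i - b i)\<^sup>2)"
          by (rule sum_mono2) auto
        also have "\<dots> = (\<Sum>i<n. (A n i - b i)\<^sup>2) + (\<Sum>i=n..<n+m. (A n i - b i)\<^sup>2)"
          using sum.atLeastLessThan_concat[of 0 n "n+m" "\<lambda>i. (A n i - b i)\<^sup>2"] by (simp add: atLeast0LessThan)
        also have "\<dots> = (\<Sum>i=n..<n+m. (d i)\<^sup>2)"
          by (simp add: Ab Aa d_def)
        also have "\<dots> = (\<Sum>i<n+m. (d i)\<^sup>2) - (\<Sum>i<n. (d i)\<^sup>2)"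
          using sum.atLeastLessThan_concat[of 0 n "n+m" "\<lambda>i. (d i)\<^sup>2"] by (simp add: atLeast0LessThan)
        finally show ?thesis
          using sum_le_l2_norm[OF dl2, of "n+m"] N[OF that] by linarith
      qed
      then show ?thesis
        using l2_norm_le_iff[of "\<epsilon>/2" "\<lambda>i. A n i - b i"] \<open>\<epsilon> > 0\<close> by (simp add: l2_dist_def)
    qed
    then show ?thesis using \<open>\<epsilon> > 0\<close> by (intro exI[of _ N]) force
  qed
  have limA: "limitin l2_topology A b sequentially"
    using Alim bl2 Al2 unfolding L2.limit_metric_sequentially by blast
  have "\<exists>N. \<forall>n\<ge>N. l2_dist (B n) b < \<epsilon>" if "\<epsilon> > 0" for \<epsilon>
  proof -
    obtain N where N: "\<And>n. n \<ge> N \<Longrightarrow> l2_dist (A n) b < \<epsilon>/2"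
      using Alim[of "\<epsilon>/2"] \<open>\<epsilon> > 0\<close> by auto
    obtain M where M: "1 / real (Suc M) < \<epsilon>/2"
      using nat_approx_posE[of "\<epsilon>/2"] \<open>\<epsilon> > 0\<close> by auto
    have "l2_dist (B n) b < \<epsilon>" if n: "n \<ge> max M N" for n
    proof -
      have "l2_dist (B n) (A (Suc n)) \<le> \<bar>T' n - T n\<bar>"
        unfolding B_def T(1) by (rule l2_dist_fun_upd_le)
      also have "\<dots> \<le> 1 / real (Suc n)" by (rule T(4))
      also have "\<dots> \<le> 1 / real (Suc M)" using n by (simp add: frac_le)
      finally have "l2_dist (B n) (A (Suc n)) < \<epsilon>/2" using M by simp
      moreover have "l2_dist (A (Suc n)) b < \<epsilon>/2" using N[of "Suc n"] n by simp
      ultimately show ?thesis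
        using L2.triangle[OF Bl2[of n] Al2[of "Suc n"] bl2] by simp
    qed
    then show ?thesis by blast
  qed
  then have limB: "limitin l2_topology B b sequentially"
    using bl2 Bl2 unfolding L2.limit_metric_sequentially by blast
  have tX: "topspace (subtopology l2_topology S) = S" using S(2) by auto
  have bS: "b \<in> S" and AS: "\<And>n. A n \<in> S" and BS: "\<And>n. B n \<in> S"
    using bE AE T(2) S(1) by (auto simp: B_def)
  have bC: "b \<in> C"
  proof (rule limitin_closedin[OF _ C(2)])
    show "limitin (subtopology l2_topology S) A b sequentially"
      using limA bS AS by (simp add: limitin_subtopology)
  qed (use AC in auto)
  \<comment> \<open>Otherwise \<open>b\<close> has a neighbourhood inside \<open>C\<close> on which
    the norm is below \<open>q\<close>. It contains some \<open>B n\<close>, which lies in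
    \<open>E_prime\<close> but was chosen outside \<open>G\<close>.\<close>
  have "l2_norm b \<ge> q"
  proof (rule ccontr)
    assume "\<not> l2_norm b \<ge> q"
    then have nb: "l2_norm b < q" by simp
    define U where "U = C \<inter> {x \<in> topspace (subtopology l2_topology S). l2_norm x \<in> {..<q}}"
    have "openin (subtopology l2_topology S) U"
      unfolding U_def
      by (intro openin_Int C(1) openin_continuous_map_preimage[where Y=euclideanreal]
          continuous_map_from_subtopology continuous_map_l2_norm) auto
    moreover have "limitin (subtopology l2_topology S) B b sequentially"
      using limB bS BS by (simp add: limitin_subtopology)
    moreover have "b \<in> U" using bC nb bS tX by (simp add: U_def)
    ultimately have "\<forall>\<^sub>F n in sequentially. B n \<in> U"
      by (simp add: limitin_def)
    then obtain n where "B n \<in> U"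
      by (auto simp: eventually_sequentially)
    then have "B n \<in> G"
      using T(2)[of n] by (simp add: G_def U_def B_def)
    then show False using T(3)[of n] by (simp add: B_def)
  qed
  then show thesis using that bE bC bq by simp
qed

section \<open>Baire category on spheres\<close>

definition sphere_c :: "real \<Rightarrow> (nat \<Rightarrow> real) set" where
  "sphere_c q = {x \<in> E_c. l2_norm x = q}"

lemma sphere_c_subset: "q \<in> \<rat> \<Longrightarrow> sphere_c q \<subseteq> E_rat_norm"
  by (auto simp: sphere_c_def E_rat_norm_def)

lemma E_rat_norm_subset_l2: "E_rat_norm \<subseteq> l2"
  using E_rat_norm_subset_E_c by (auto simp: E_c_def)

lemma E_prime_subset_E_rat_norm: "E_prime \<subseteq> E_rat_norm"
  by (auto simp: E_rat_norm_def)

lemma topspace_E_rat_norm: "topspace (subtopology l2_topology E_rat_norm) = E_rat_norm"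
  using E_rat_norm_subset_l2 by auto

lemma E_prime_meets_open:
  assumes "openin l2_topology U" "U \<noteq> {}"
  obtains a where "a \<in> E_prime" "a \<in> U"
proof -
  obtain x where "x \<in> U" using assms by blast
  then obtain r where r: "r > 0" "L2.mball x r \<subseteq> U" and x: "x \<in> l2"
    using assms unfolding L2.openin_mtopology by blast
  obtain y where "y \<in> E_prime" "l2_dist y x < r"
    using E_prime_dense[OF x r(1)] .
  then show thesis
    using that r x E_prime_subset_l2 L2.commute by force
qed

text \<open>This opens the way to the Baire category theorem: a G_delta-set in the completely
  metrizable \<open>l2_topology\<close> is completely metrizable.\<close>

lemma gdelta_sphere_c:
  assumes "open V" shows "gdelta_in l2_topology (sphere_c q \<inter> V)"
proof -
  have 1: "gdelta_in l2_topology {x \<in> topspace l2_topology. x n \<in> - \<rat>}" for n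
  proof -
    have "topspace l2_topology - {x \<in> topspace l2_topology. x n \<in> - \<rat>} = {x \<in> topspace l2_topology. x n \<in> \<rat>}"
      by auto
    moreover have "fsigma_in l2_topology \<dots>"
      by (intro fsigma_in_continuous_map_preimage[OF continuous_map_l2_coordinate] fsigma_in_countable)
         (auto simp: countable_rat t1_space_euclidean)
    ultimately show ?thesis
      unfolding gdelta_in_fsigma_in by auto
  qed
  have 2: "closedin l2_topology {x \<in> topspace l2_topology. l2_norm x \<in> {q}}"
    by (rule closedin_continuous_map_preimage[OF continuous_map_l2_norm]) simp
  have 3: "openin l2_topology {x \<in> topspace l2_topology. x \<in> V}"
    by (rule openin_continuous_map_preimage[OF continuous_map_l2_euclidean]) (use assms in simp)
  have "sphere_c q \<inter> V = \<Inter> (range (\<lambda>n. {x \<in> topspace l2_topology. x n \<in> - \<rat>}))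
      \<inter> ({x \<in> topspace l2_topology. l2_norm x \<in> {q}} \<inter> {x \<in> topspace l2_topology. x \<in> V})"
    by (auto simp: sphere_c_def E_c_def)
  moreover have "gdelta_in l2_topology \<dots>"
    using 1 by (intro gdelta_in_Int gdelta_in_Inter closed_imp_gdelta_in[OF metrizable_l2 2] open_imp_gdelta_in[OF 3]) auto
  ultimately show ?thesis by simp
qed

section \<open>Graphs of weakly continuous maps with rational coordinates\<close>

locale rational_map =
  fixes h :: "(nat \<Rightarrow> real) \<Rightarrow> (nat \<Rightarrow> real)"
  assumes cont: "continuous_map (subtopology l2_topology E_rat_norm) euclidean h"
    and rat: "x \<in> E_rat_norm \<Longrightarrow> h x i \<in> \<rat>"
begin

abbreviation X where "X \<equiv> subtopology l2_topology E_rat_norm"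

text \<open>The value comes first, matching the product of the Erdos space with \<open>l2\<close> in
  which the graph will be closed.\<close>

definition graph :: "(nat \<Rightarrow> real) \<Rightarrow> (nat \<Rightarrow> real) \<times> (nat \<Rightarrow> real)" where
  "graph x = (h x, x)"

lemma continuous_map_id: "continuous_map X euclidean (\<lambda>x. x)"
  by (intro continuous_map_from_subtopology continuous_map_l2_euclidean)

lemma continuous_map_graph: "continuous_map X euclidean graph"
  using continuous_map_pairedI[OF cont continuous_map_id]
  by (simp add: graph_def[abs_def])

text \<open>The coordinates of \<open>h x\<close> are rational and those of \<open>x\<close>
  irrational, so on either factor the boundary points of intervals can be taken where no coordinate
  lies. Through this clopen neighbourhood Erdos' argument applies to the graph.\<close>

lemma graph_clopen_nbhd:
  assumes "x \<in> E_rat_norm" "open U" "graph x \<in> U"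
  obtains C where "openin X C" "closedin X C" "x \<in> C" "graph ` C \<subseteq> U"
proof -
  obtain A B where AB: "open A" "open B" "graph x \<in> A \<times> B" "A \<times> B \<subseteq> U"
    using open_prod_elim[OF assms(2,3)] .
  have xX: "x \<in> topspace X" using assms(1) topspace_E_rat_norm by simp
  have irr: "\<exists>d\<in>-\<rat>. a < d \<and> d < b" if "a < b" for a b :: real
  proof -
    have "a - sqrt 2 < b - sqrt 2" using that by simp
    then obtain r where r: "r \<in> \<rat>" "a - sqrt 2 < r" "r < b - sqrt 2"
      using Rats_dense_in_real by blast
    then have "r + sqrt 2 \<in> -\<rat>" using Rats_plus_irrational by blast
    moreover have "a < r + sqrt 2" "r + sqrt 2 < b" using r by linarith+
    ultimately show ?thesis by blast
  qed
  have hA: "h x \<in> A" and xB: "x \<in> B" using AB(3) by (auto simp: graph_def)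
  obtain C1 where C1: "openin X C1" "closedin X C1" "x \<in> C1" "h ` C1 \<subseteq> A"
    by (rule clopen_nbhd_of_product_open[where e=h and D="-\<rat>", OF cont irr _ AB(1) xX hA])
       (use rat topspace_E_rat_norm in blast)+
  obtain C2 where C2: "openin X C2" "closedin X C2" "x \<in> C2" "(\<lambda>x. x) ` C2 \<subseteq> B"
    by (rule clopen_nbhd_of_product_open[where e="\<lambda>x. x" and D=\<rat> and x=x and U=B,
          OF continuous_map_id Rats_dense_in_real _ AB(2) xX xB])
       (use E_rat_norm_subset_E_c topspace_E_rat_norm in \<open>auto simp: E_c_def\<close>)
  show thesis
  proof
    have "graph ` (C1 \<inter> C2) \<subseteq> A \<times> B"
      using C1(4) C2(4) by (auto simp: graph_def)
    then show "graph ` (C1 \<inter> C2) \<subseteq> U"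
      using AB(4) by blast
  qed (use C1 C2 in auto)
qed

text \<open>If \<open>graph a\<close> were off the closure, so would be the graph over some clopen
  neighbourhood of \<open>a\<close> inside \<open>V\<close>. But Erdos' argument finds a point of
  norm \<open>q\<close> in that neighbourhood.\<close>

lemma E_prime_graph_in_closure:
  assumes q: "q \<in> \<rat>" and V: "open V" and a: "a \<in> E_prime" "a \<in> V" "l2_norm a < q"
  shows "graph a \<in> closure (graph ` (sphere_c q \<inter> V))"
proof (rule ccontr)
  let ?K = "closure (graph ` (sphere_c q \<inter> V))"
  assume na: "graph a \<notin> ?K"
  have aS: "a \<in> E_rat_norm" using a(1) E_prime_subset_E_rat_norm by blast
  have 1: "open ((- ?K) \<inter> (UNIV \<times> V))"
    using V by (intro open_Int open_Times) auto
  have 2: "graph a \<in> (- ?K) \<inter> (UNIV \<times> V)"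
    using na a(2) by (simp add: graph_def)
  obtain C where C: "openin X C" "closedin X C" "a \<in> C" "graph ` C \<subseteq> (- ?K) \<inter> (UNIV \<times> V)"
    by (rule graph_clopen_nbhd[OF aS 1 2])
  obtain b where b: "b \<in> E_prime" "b \<in> C" "l2_norm b = q"
    using erdos_argument[OF E_prime_subset_E_rat_norm E_rat_norm_subset_l2 C(1,2) a(1) C(3) a(3)] .
  have "graph b \<in> (- ?K) \<inter> (UNIV \<times> V)" using b(2) C(4) by blast
  moreover have "b \<in> sphere_c q" using b E_prime_subset_E_c by (auto simp: sphere_c_def)
  ultimately have "b \<in> sphere_c q \<inter> V" "graph b \<notin> ?K"
    by (auto simp: graph_def)
  then have "graph b \<in> graph ` (sphere_c q \<inter> V)" by blast
  then have "graph b \<in> ?K" by (rule subsetD[OF closure_subset])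
  with \<open>graph b \<notin> ?K\<close> show False by contradiction
qed

text \<open>The exceptional points form an open subset of \<open>X\<close> in the norm topology. If
  nonempty it would meet the dense set \<open>E_prime\<close>, where the claim is known.\<close>

lemma graph_in_closure:
  assumes q: "q \<in> \<rat>" and V: "open V" and x: "x \<in> E_rat_norm" "x \<in> V" "l2_norm x < q"
  shows "graph x \<in> closure (graph ` (sphere_c q \<inter> V))"
proof (rule ccontr)
  let ?K = "closure (graph ` (sphere_c q \<inter> V))"
  assume nx: "graph x \<notin> ?K"
  define U where "U = {x \<in> topspace X. graph x \<in> - ?K} \<inter> {x \<in> topspace X. x \<in> V} \<inter> {x \<in> topspace X. l2_norm x \<in> {..<q}}"
  have "openin X U"
    unfolding U_def
    by (intro openin_Int openin_continuous_map_preimage[OF continuous_map_graph]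
        openin_continuous_map_preimage[OF continuous_map_id]
        openin_continuous_map_preimage[where Y=euclideanreal] continuous_map_from_subtopology
        continuous_map_l2_norm) (use V in auto)
  then obtain O' where O': "openin l2_topology O'" "U = O' \<inter> E_rat_norm"
    unfolding openin_subtopology by blast
  have "x \<in> U" using x nx topspace_E_rat_norm by (simp add: U_def)
  then obtain a where a: "a \<in> E_prime" "a \<in> O'"
    using E_prime_meets_open[OF O'(1)] O'(2) by blast
  then have "a \<in> U" using O'(2) E_prime_subset_E_rat_norm by blast
  then show False
    using E_prime_graph_in_closure[OF q V a(1)] by (auto simp: U_def)
qed

text \<open>By the Baire category theorem the part of the sphere whose graph lies in some member of
  \<open>\<F>\<close> has interior in the norm topology. As the norm is constant on the sphere, the
  Kadec-Klee property replaces the norm ball by a weakly open set.\<close>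

lemma baire_step:
  assumes q: "q \<in> \<rat>" and V: "open V" "sphere_c q \<inter> V \<noteq> {}"
    and F: "countable \<F>" "\<And>F. F \<in> \<F> \<Longrightarrow> closed F" "graph ` (sphere_c q \<inter> V) \<subseteq> \<Union> \<F>"
  obtains W F where "open W" "W \<subseteq> V" "F \<in> \<F>" "sphere_c q \<inter> W \<noteq> {}" "graph ` (sphere_c q \<inter> W) \<subseteq> F"
proof -
  define T where "T = sphere_c q \<inter> V"
  define Y where "Y = subtopology l2_topology T"
  have TS: "T \<subseteq> E_rat_norm" using sphere_c_subset[OF q] by (auto simp: T_def)
  then have tY: "topspace Y = T" using E_rat_norm_subset_l2 by (auto simp: Y_def)
  have cm: "completely_metrizable_space Y"
    unfolding Y_def T_def
    by (intro completely_metrizable_space_gdelta_in completely_metrizable_l2 gdelta_sphere_c V(1))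
  define P where "P F = {x \<in> topspace Y. graph x \<in> F}" for F
  have "Y = subtopology X T"
    using TS by (simp add: Y_def subtopology_subtopology Int_absorb1)
  then have cg: "continuous_map Y euclidean graph"
    using continuous_map_graph continuous_map_from_subtopology by blast
  have clP: "closedin Y (P F)" if "F \<in> \<F>" for F
    unfolding P_def using F(2)[OF that] by (intro closedin_continuous_map_preimage[OF cg]) simp
  have "\<exists>F\<in>\<F>. Y interior_of (P F) \<noteq> {}"
  proof (rule ccontr)
    assume "\<not> (\<exists>F\<in>\<F>. Y interior_of (P F) \<noteq> {})"
    then have "Y interior_of \<Union> (P ` \<F>) = {}"
      using clP F(1) cm by (intro Baire_category_alt) auto
    moreover have "\<Union> (P ` \<F>) = topspace Y"
      using F(3) by (auto simp: P_def tY T_def)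
    ultimately show False
      using V(2) interior_of_topspace[of Y] by (simp add: tY T_def)
  qed
  then obtain F p where F': "F \<in> \<F>" "p \<in> Y interior_of (P F)" by blast
  then obtain U where U: "openin Y U" "p \<in> U" "U \<subseteq> P F"
    unfolding interior_of_def by blast
  then obtain O' where O': "openin l2_topology O'" "U = O' \<inter> T"
    unfolding Y_def openin_subtopology by blast
  then have "p \<in> O'" "p \<in> T" using U by auto
  then obtain r where r: "r > 0" "L2.mball p r \<subseteq> O'"
    using O' unfolding L2.openin_mtopology by blast
  have pl2: "p \<in> l2" using \<open>p \<in> T\<close> TS E_rat_norm_subset_l2 by blast
  obtain W \<delta> where W: "open W" "p \<in> W" "\<delta> > 0"
    "\<And>x. x \<in> l2 \<Longrightarrow> x \<in> W \<Longrightarrow> l2_norm x < l2_norm p + \<delta> \<Longrightarrow> l2_dist x p < r"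
    using kadec_klee_l2[OF pl2 r(1)] by blast
  show thesis
  proof (rule that[of "W \<inter> V" F])
    show "open (W \<inter> V)" using W V by auto
    show "sphere_c q \<inter> (W \<inter> V) \<noteq> {}" using W \<open>p \<in> T\<close> by (auto simp: T_def)
    show "graph ` (sphere_c q \<inter> (W \<inter> V)) \<subseteq> F"
    proof (rule image_subsetI)
      fix x assume "x \<in> sphere_c q \<inter> (W \<inter> V)"
      then have x: "x \<in> sphere_c q" "x \<in> W" "x \<in> V" by auto
      then have xT: "x \<in> T" by (simp add: T_def)
      then have xl2: "x \<in> l2" using TS E_rat_norm_subset_l2 by blast
      have "l2_norm x = l2_norm p"
        using x \<open>p \<in> T\<close> by (simp add: T_def sphere_c_def)
      then have "x \<in> L2.mball p r"
        using W(3,4) x xl2 pl2 by (simp add: L2.commute[of p x])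
      then have "x \<in> U" using r O' xT by blast
      then show "graph x \<in> F" using U(3) by (auto simp: P_def)
    qed
  qed (use F' in auto)
qed

text \<open>The constants \<open>c\<close> and \<open>r\<close> are a first coordinate and a norm that the limit point is to avoid.\<close>

lemma shrinking_step:
  assumes q: "q \<in> \<rat>" and V: "open V" "sphere_c q \<inter> V \<noteq> {}"
    and F: "countable \<F>" "\<And>F. F \<in> \<F> \<Longrightarrow> closed F"
      "\<And>x. x \<in> E_rat_norm \<Longrightarrow> x 0 \<noteq> c \<Longrightarrow> l2_norm x \<noteq> r \<Longrightarrow> graph x \<in> \<Union> \<F>"
  obtains q' W F where "q' \<in> \<rat>" "open W" "F \<in> \<F>" "sphere_c q' \<inter> W \<noteq> {}"
    "graph ` (sphere_c q' \<inter> W) \<subseteq> F"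
    "graph ` (sphere_c q' \<inter> W) \<subseteq> closure (graph ` (sphere_c q \<inter> V))"
proof -
  define V1 where "V1 = V \<inter> {x. x 0 \<noteq> c}"
  have oV1: "open V1"
    unfolding V1_def using V(1) by (intro open_Int open_Collect_neq continuous_intros) auto
  \<comment> \<open>A point \<open>p\<close> of the sphere is scaled down slightly. The result stays
    in \<open>V\<close> and has norm below \<open>q\<close>, and a nearby point of
    \<open>E_prime\<close> shares these open properties.\<close>
  obtain a where a: "a \<in> E_prime" "a \<in> V1" "l2_norm a < q"
  proof -
    obtain p where p: "p \<in> sphere_c q" "p \<in> V" using V(2) by blast
    then have pl2: "p \<in> l2" and pq: "l2_norm p = q" and "p 0 \<notin> \<rat>"
      by (auto simp: sphere_c_def E_c_def)
    then have p0: "p 0 \<noteq> 0" by (metis Rats_0)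
    then have q0: "q > 0" using abs_le_l2_norm[OF pl2, of 0] pq by linarith
    have "openin l2_topology {x \<in> topspace l2_topology. x \<in> V}"
      by (rule openin_continuous_map_preimage[OF continuous_map_l2_euclidean]) (use V in simp)
    moreover have "p \<in> {x \<in> topspace l2_topology. x \<in> V}" using p pl2 by simp
    ultimately obtain e where e: "e > 0" "L2.mball p e \<subseteq> {x \<in> topspace l2_topology. x \<in> V}"
      unfolding L2.openin_mtopology by blast
    \<comment> \<open>A factor \<open>t\<close> between \<open>t0\<close> and 1 moves
      \<open>p\<close> by \<open>(1 - t) * q\<close>, which is less than \<open>e\<close>.\<close>
    define t0 where "t0 = max 0 (1 - e / q)"
    have t0: "0 \<le> t0" "t0 < 1" "1 - e / q \<le> t0" using e(1) q0 by (auto simp: t0_def)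
    \<comment> \<open>Of two different factors at most one gives the first coordinate
      \<open>c\<close>, because \<open>p 0\<close> is irrational and so not 0.\<close>
    obtain t where t: "t0 < t" "t < 1" "t * p 0 \<noteq> c"
    proof -
      obtain s where s: "t0 < s" "s < 1" using dense[OF t0(2)] by blast
      obtain s' where s': "s < s'" "s' < 1" using dense[OF s(2)] by blast
      have "s * p 0 \<noteq> s' * p 0" using p0 s'(1) by simp
      then show thesis using that[of s] that[of s'] s s' by fastforce
    qed
    define x where "x n = t * p n" for n
    have sc: "l2_norm (\<lambda>n. u * p n) = \<bar>u\<bar> * q" for u
      unfolding pq[symmetric] l2_norm_def
      by (simp add: power_mult_distrib infsum_cmult_right' real_sqrt_mult)
    have "x \<in> l2"
      using pl2 unfolding x_def l2_iff_summable by (simp add: power_mult_distrib summable_mult)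
    moreover have "l2_dist p x < e"
    proof -
      have "l2_dist p x = \<bar>1 - t\<bar> * q"
        unfolding sc[symmetric] l2_dist_def x_def by (simp add: algebra_simps)
      also have "\<dots> < (e / q) * q"
        using t t0 q0 by (intro mult_strict_right_mono) auto
      finally show ?thesis using q0 by simp
    qed
    ultimately have "x \<in> V" using e(2) pl2 by auto
    have "l2_norm x < q"
    proof -
      have "l2_norm x = t * q" using sc[of t] t t0 unfolding x_def by simp
      then show ?thesis using t q0 by simp
    qed
    define O' where "O' = {x \<in> topspace l2_topology. x \<in> V1} \<inter> {x \<in> topspace l2_topology. l2_norm x \<in> {..<q}}"
    have "openin l2_topology O'"
      unfolding O'_def
      by (intro openin_Int openin_continuous_map_preimage[OF continuous_map_l2_euclidean]
          openin_continuous_map_preimage[OF continuous_map_l2_norm]) (use oV1 in auto)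
    moreover have "x \<in> O'"
      using \<open>x \<in> l2\<close> \<open>x \<in> V\<close> \<open>l2_norm x < q\<close> t(3) by (simp add: O'_def V1_def x_def)
    ultimately obtain a where "a \<in> E_prime" "a \<in> O'"
      using E_prime_meets_open by blast
    then show thesis using that by (auto simp: O'_def)
  qed
  \<comment> \<open>Likewise, of two rational candidates at most one equals
    \<open>r\<close>.\<close>
  obtain q' where q': "q' \<in> \<rat>" "l2_norm a < q'" "q' < q" "q' \<noteq> r"
  proof -
    obtain s where s: "s \<in> \<rat>" "l2_norm a < s" "s < q"
      using Rats_dense_in_real[OF a(3)] by blast
    obtain s' where s': "s' \<in> \<rat>" "s < s'" "s' < q"
      using Rats_dense_in_real[OF s(3)] by blast
    show thesis using that[of s] that[of s'] s s' by fastforce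
  qed
  have aS: "a \<in> E_rat_norm" using a(1) E_prime_subset_E_rat_norm by blast
  have 1: "open (UNIV \<times> V1)" using oV1 by (intro open_Times) auto
  have 2: "graph a \<in> UNIV \<times> V1" using a(2) by (simp add: graph_def)
  obtain C where C: "openin X C" "closedin X C" "a \<in> C" "graph ` C \<subseteq> UNIV \<times> V1"
    by (rule graph_clopen_nbhd[OF aS 1 2])
  obtain b where b: "b \<in> E_prime" "b \<in> C" "l2_norm b = q'"
    using erdos_argument[OF E_prime_subset_E_rat_norm E_rat_norm_subset_l2 C(1,2) a(1) C(3) q'(2)] .
  have "b \<in> V1" using C(4) b(2) by (auto simp: graph_def)
  moreover have "b \<in> sphere_c q'" using b E_prime_subset_E_c by (auto simp: sphere_c_def)
  ultimately have ne: "sphere_c q' \<inter> V1 \<noteq> {}" by blast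
  \<comment> \<open>\<open>V1\<close> excludes the first coordinate \<open>c\<close> and the choice
    of \<open>q'\<close> excludes the norm \<open>r\<close>, so the cover by \<open>\<F>\<close> is
    available on this part of the sphere.\<close>
  have covV1: "graph ` (sphere_c q' \<inter> V1) \<subseteq> \<Union> \<F>"
  proof (rule image_subsetI)
    fix x assume x: "x \<in> sphere_c q' \<inter> V1"
    show "graph x \<in> \<Union> \<F>"
    proof (rule F(3))
      show "x \<in> E_rat_norm" using x sphere_c_subset[OF q'(1)] by blast
      show "x 0 \<noteq> c" using x by (simp add: V1_def)
      show "l2_norm x \<noteq> r" using x q'(4) by (simp add: sphere_c_def)
    qed
  qed
  obtain W F where W: "open W" "W \<subseteq> V1" "F \<in> \<F>" "sphere_c q' \<inter> W \<noteq> {}"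
      "graph ` (sphere_c q' \<inter> W) \<subseteq> F"
    by (rule baire_step[OF q'(1) oV1 ne F(1,2) covV1])
  have "graph ` (sphere_c q' \<inter> W) \<subseteq> closure (graph ` (sphere_c q \<inter> V))"
  proof (rule image_subsetI)
    fix x assume x: "x \<in> sphere_c q' \<inter> W"
    show "graph x \<in> closure (graph ` (sphere_c q \<inter> V))"
    proof (rule graph_in_closure[OF q V(1)])
      show "x \<in> E_rat_norm" using x sphere_c_subset[OF q'(1)] by blast
      show "x \<in> V" using x W(2) by (auto simp: V1_def)
      show "l2_norm x < q" using x q'(3) by (simp add: sphere_c_def)
    qed
  qed
  then show thesis using that[OF q'(1) W(1,3,4,5)] by blast
qed

end

section \<open>The graph is not a weak F_sigma-delta set\<close>

text \<open>The closed sets that make up \<open>H\<close> are cut by the closed balls of radius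
  \<open>\<epsilon>/2\<close> around a countable dense set. Small pieces make the nested sequence of
  closures below shrink to a point.\<close>

lemma fsigma_small_pieces:
  fixes H :: "'a::{metric_space, second_countable_topology} set"
  assumes H: "fsigma_in euclidean H" and "\<epsilon> > 0"
  shows "\<exists>\<F>. countable \<F> \<and> (\<forall>F\<in>\<F>. closed F) \<and> \<Union> \<F> = H \<and> (\<forall>F\<in>\<F>. \<forall>y\<in>F. \<forall>z\<in>F. dist y z \<le> \<epsilon>)"
proof -
  obtain C where C: "\<And>n::nat. closed (C n)" "\<Union> (range C) = H"
    using H by (auto simp: fsigma_in_ascending)
  obtain D :: "'a set" where D: "countable D" "\<And>U. open U \<Longrightarrow> U \<noteq> {} \<Longrightarrow> \<exists>d\<in>D. d \<in> U"
    using countable_dense_exists by metis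
  let ?\<F> = "(\<lambda>(n, d). C n \<inter> cball d (\<epsilon>/2)) ` (UNIV \<times> D)"
  show ?thesis
  proof (intro exI[of _ ?\<F>] conjI ballI)
    show "countable ?\<F>" using D(1) by (intro countable_image countable_SIGMA) auto
    show "\<Union> ?\<F> = H"
    proof
      show "H \<subseteq> \<Union> ?\<F>"
      proof
        fix x assume "x \<in> H"
        then obtain n where n: "x \<in> C n" using C(2) by blast
        obtain d where "d \<in> D" "d \<in> ball x (\<epsilon>/2)"
          using D(2)[of "ball x (\<epsilon>/2)"] \<open>\<epsilon> > 0\<close> by auto
        then show "x \<in> \<Union> ?\<F>"
          using n by (intro UnionI[of "C n \<inter> cball d (\<epsilon>/2)"]) (auto simp: dist_commute)
      qed
    qed (use C(2) in auto)
  next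
    fix F assume "F \<in> ?\<F>"
    then obtain n d where F: "F = C n \<inter> cball d (\<epsilon>/2)" by auto
    then show "closed F" using C(1) by auto
  next
    fix F y z assume "F \<in> ?\<F>"
    then obtain n d where F: "F = C n \<inter> cball d (\<epsilon>/2)" by auto
    assume "y \<in> F" "z \<in> F"
    then have "dist d y \<le> \<epsilon>/2" "dist d z \<le> \<epsilon>/2" using F by auto
    then show "dist y z \<le> \<epsilon>" using dist_triangle3[of y z d] by simp
  qed
qed

text \<open>Iterating \<open>shrinking_step\<close> gives nested closed sets with diameters tending
  to 0. Their common point is in every \<open>G n\<close>, hence is \<open>graph x\<close> for some
  \<open>x\<close> in the space, yet \<open>x\<close> has neither a first coordinate allowed in
  \<open>E_prime\<close> nor a rational norm.\<close>

lemma (in rational_map) not_fsigmadelta_graph: "\<not> fsigmadelta_in euclidean (graph ` E_rat_norm)"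
proof
  assume "fsigmadelta_in euclidean (graph ` E_rat_norm)"
  then obtain G where G: "\<And>n::nat. fsigma_in euclidean (G n)" "graph ` E_rat_norm = (\<Inter>n. G n)"
    using fsigmadelta_in_sequence by metis
  define c where "c = from_nat_into ((\<lambda>q::real. q + sqrt 2) ` \<rat>)"
  have c: "range c = (\<lambda>q. q + sqrt 2) ` \<rat>"
    unfolding c_def using Rats_0 by (intro range_from_nat_into countable_image countable_rat) blast
  define r where "r = from_nat_into (\<rat> :: real set)"
  have r: "range r = \<rat>"
    unfolding r_def using Rats_0 by (intro range_from_nat_into countable_rat) blast
  \<comment> \<open>Stage \<open>n\<close> discards the \<open>n\<close>-th forbidden first
    coordinate and the \<open>n\<close>-th rational norm. What remains in \<open>l2\<close> is
    norm-open, hence weakly F_sigma, so \<open>H n\<close> is F_sigma like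
    \<open>G n\<close>.\<close>
  define H where "H n = G n \<inter> (UNIV \<times> {x \<in> l2. x 0 \<noteq> c n \<and> l2_norm x \<noteq> r n})" for n
  have H: "fsigma_in euclidean (H n)" for n
  proof -
    have "{x \<in> l2. x 0 \<noteq> c n \<and> l2_norm x \<noteq> r n} =
        {x \<in> topspace l2_topology. x 0 \<in> - {c n}} \<inter> {x \<in> topspace l2_topology. l2_norm x \<in> - {r n}}"
      by auto
    moreover have "openin l2_topology \<dots>"
      by (intro openin_Int openin_continuous_map_preimage[OF continuous_map_l2_coordinate]
          openin_continuous_map_preimage[OF continuous_map_l2_norm]) auto
    ultimately have "fsigma_in euclidean {x \<in> l2. x 0 \<noteq> c n \<and> l2_norm x \<noteq> r n}"
      using fsigma_l2_open by simp
    moreover have "fsigma_in euclidean (UNIV :: (nat \<Rightarrow> real) set)"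
      using fsigma_in_topspace[of euclidean] by simp
    ultimately show ?thesis
      unfolding H_def by (intro fsigma_in_Int G fsigma_in_euclidean_Times)
  qed
  have "\<forall>n. \<exists>\<F>. countable \<F> \<and> (\<forall>F\<in>\<F>. closed F) \<and> \<Union> \<F> = H n \<and>
      (\<forall>F\<in>\<F>. \<forall>y\<in>F. \<forall>z\<in>F. dist y z \<le> 1 / real (Suc n))"
    by (intro allI fsigma_small_pieces[OF H]) simp
  from choice[OF this] obtain \<F> where \<F>: "\<forall>n. countable (\<F> n) \<and> (\<forall>F\<in>\<F> n. closed F) \<and> \<Union> (\<F> n) = H n \<and>
      (\<forall>F\<in>\<F> n. \<forall>y\<in>F. \<forall>z\<in>F. dist y z \<le> 1 / real (Suc n))" ..
  have F: "countable (\<F> n)" "\<And>F. F \<in> \<F> n \<Longrightarrow> closed F" "\<Union> (\<F> n) = H n"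
    "\<And>F y z. F \<in> \<F> n \<Longrightarrow> y \<in> F \<Longrightarrow> z \<in> F \<Longrightarrow> dist y z \<le> 1 / real (Suc n)" for n
    using \<F>[rule_format, of n] by blast+
  have cov: "graph x \<in> \<Union> (\<F> n)" if "x \<in> E_rat_norm" "x 0 \<noteq> c n" "l2_norm x \<noteq> r n" for x n
  proof -
    have "graph x \<in> G n" using that(1) G(2) by blast
    then show ?thesis
      unfolding F(3) H_def using that E_rat_norm_subset_l2 by (auto simp: graph_def)
  qed
  define K where "K s = graph ` (sphere_c (fst s) \<inter> snd s)" for s
  define P where "P s \<longleftrightarrow> fst s \<in> \<rat> \<and> open (snd s) \<and> sphere_c (fst s) \<inter> snd s \<noteq> {}" for s
  have "\<exists>f. \<forall>n. P (f n) \<and> (\<exists>F\<in>\<F> n. K (f (Suc n)) \<subseteq> F \<and> K (f (Suc n)) \<subseteq> closure (K (f n)))"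
  proof (rule dependent_nat_choice)
    obtain a where a: "a \<in> E_prime" using E_prime_dense[OF zero_in_l2, of 1] by auto
    obtain q where q: "q \<in> \<rat>" "l2_norm a < q"
      using Rats_dense_in_real[of "l2_norm a" "l2_norm a + 1"] by auto
    \<comment> \<open>Erdos' argument in the whole space, which is clopen in itself, shows that the
      first sphere is nonempty.\<close>
    obtain b where "b \<in> E_prime" "l2_norm b = q"
    proof (rule erdos_argument[OF E_prime_subset_E_rat_norm E_rat_norm_subset_l2 openin_topspace closedin_topspace a _ q(2)])
      show "a \<in> topspace X" using a E_prime_subset_E_rat_norm topspace_E_rat_norm by blast
    qed
    then have "b \<in> sphere_c q" using E_prime_subset_E_c by (auto simp: sphere_c_def)
    then show "\<exists>s. P s"
      using q by (intro exI[of _ "(q, UNIV)"]) (auto simp: P_def)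
  next
    fix s n assume s: "P s"
    obtain q' W F where "q' \<in> \<rat>" "open W" "F \<in> \<F> n" "sphere_c q' \<inter> W \<noteq> {}"
      "graph ` (sphere_c q' \<inter> W) \<subseteq> F"
      "graph ` (sphere_c q' \<inter> W) \<subseteq> closure (graph ` (sphere_c (fst s) \<inter> snd s))"
    proof (rule shrinking_step[of "fst s" "snd s" "\<F> n" "c n" "r n"])
      show "graph x \<in> \<Union> (\<F> n)" if "x \<in> E_rat_norm" "x 0 \<noteq> c n" "l2_norm x \<noteq> r n" for x
        using that by (rule cov)
    qed (use s F in \<open>auto simp: P_def\<close>)
    then show "\<exists>s'. P s' \<and> (\<exists>F\<in>\<F> n. K s' \<subseteq> F \<and> K s' \<subseteq> closure (K s))"
      by (intro exI[of _ "(q', W)"]) (auto simp: P_def K_def)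
  qed
  then obtain f where f: "\<And>n. P (f n)"
      "\<And>n. \<exists>F\<in>\<F> n. K (f (Suc n)) \<subseteq> F \<and> K (f (Suc n)) \<subseteq> closure (K (f n))"
    by blast
  \<comment> \<open>The shift by one matches the recursion: it is the graph part at
    \<open>Suc n\<close> that lies in a member of \<open>\<F> n\<close>.\<close>
  define L where "L n = closure (K (f (Suc n)))" for n
  have L: "\<exists>F\<in>\<F> n. L n \<subseteq> F" for n
    using f(2)[of n] F(2) unfolding L_def by (meson closure_minimal)
  have dec: "L (Suc n) \<subseteq> L n" for n
    using f(2)[of "Suc n"] unfolding L_def by (meson closure_minimal closed_closure)
  \<comment> \<open>Cantor's intersection theorem in the complete product of two sequence spaces;
    \<open>L n\<close> has diameter at most \<open>1 / real (Suc n)\<close>.\<close>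
  have "\<exists>z. \<forall>n. z \<in> L n"
  proof (rule decreasing_closed_nest)
    show "closed (L n)" for n by (simp add: L_def)
    show "L n \<noteq> {}" for n
      using f(1)[of "Suc n"] by (auto simp: L_def P_def K_def)
    show "L n \<subseteq> L m" if "m \<le> n" for m n
      using dec that by (rule lift_Suc_antimono_le)
    show "\<exists>n. \<forall>x\<in>L n. \<forall>y\<in>L n. dist x y < \<epsilon>" if \<epsilon>: "\<epsilon> > 0" for \<epsilon>
    proof -
      obtain n where "1 / real (Suc n) < \<epsilon>" by (rule nat_approx_posE[OF \<epsilon>])
      moreover obtain F where "F \<in> \<F> n" "L n \<subseteq> F" using L by blast
      ultimately have "\<forall>x\<in>L n. \<forall>y\<in>L n. dist x y < \<epsilon>"
        using F(4) by (meson le_less_trans subsetD)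
      then show ?thesis ..
    qed
  qed blast
  then obtain z where z: "\<And>n. z \<in> L n" by blast
  have zH: "z \<in> H n" for n
    using z[of n] L[of n] F(3)[of n] by blast
  then have "z \<in> graph ` E_rat_norm"
    unfolding G(2) by (auto simp: H_def)
  then obtain x where x: "x \<in> E_rat_norm" "z = graph x" by blast
  have x0: "x 0 \<noteq> c n" and xn: "l2_norm x \<noteq> r n" for n
    using zH[of n] x(2) by (auto simp: H_def graph_def)
  have "x 0 \<notin> (\<lambda>q. q + sqrt 2) ` \<rat>" using x0 c by (metis rangeE)
  then have "x \<notin> E_prime" by (auto simp: E_prime_def)
  moreover have "l2_norm x \<notin> \<rat>" using xn r by (metis rangeE)
  ultimately show False using x(1) by (auto simp: E_rat_norm_def)
qed

section \<open>Factors of the Erdos space\<close>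

lemma fsigmadelta_Erdos_Times_l2: "fsigmadelta_in euclidean ({x \<in> l2. \<forall>n. x n \<in> \<rat>} \<times> l2)"
proof -
  have l2: "fsigma_in euclidean l2"
    using fsigma_l2_open[OF openin_topspace] by simp
  have "fsigma_in euclidean {x \<in> topspace euclidean. (x::nat \<Rightarrow> real) n \<in> \<rat>}" for n
    by (rule fsigma_in_continuous_map_preimage[where Y=euclideanreal])
       (auto intro!: fsigma_in_countable simp: countable_rat t1_space_euclidean)
  then have Q: "fsigmadelta_in euclidean (l2 \<inter> (\<Inter>n. {x. x n \<in> \<rat>}))"
    by (intro fsigmadelta_in_Int fsigmadelta_in_INT fsigma_imp_fsigmadelta_in l2) simp
  have "{x \<in> l2. \<forall>n. x n \<in> \<rat>} \<times> l2 =
      {z \<in> topspace euclidean. fst z \<in> l2 \<inter> (\<Inter>n. {x. x n \<in> \<rat>})} \<inter> {z \<in> topspace euclidean. snd z \<in> l2}"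
    by auto
  moreover have "fsigmadelta_in euclidean \<dots>"
    by (intro fsigmadelta_in_Int fsigmadelta_in_continuous_map_preimage[OF _ Q]
        fsigmadelta_in_continuous_map_preimage[OF _ fsigma_imp_fsigmadelta_in[OF l2]])
       (auto simp: continuous_on_fst continuous_on_snd)
  ultimately show ?thesis by simp
qed

text \<open>The set is the trace of a norm-closed set on the product of the points of the Erdos
  space with \<open>l2\<close>, which is weakly F_sigma-delta. The complement of the norm-closed set
  is weakly F_sigma, so the trace only adds a G_delta condition.\<close>

lemma fsigmadelta_closed_in_Erdos_prod:
  assumes "closedin (prod_topology Erdos_space l2_topology) A"
  shows "fsigmadelta_in euclidean A"
proof -
  let ?Q = "{x \<in> l2. \<forall>n. x n \<in> \<rat>}"
  have eq: "prod_topology Erdos_space l2_topology = subtopology (prod_topology l2_topology l2_topology) (?Q \<times> l2)"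
    unfolding Erdos_space_def prod_topology_subtopology
    by (simp add: subtopology_subtopology Sigma_Int_distrib1 Times_Int_Times subtopology_restrict Int_absorb1 Int_absorb2)
  obtain T where T: "closedin (prod_topology l2_topology l2_topology) T" "A = T \<inter> (?Q \<times> l2)"
    using assms unfolding eq closedin_subtopology by (elim exE conjE) (rule that)
  define U where "U = l2 \<times> l2 - T"
  have "openin (prod_topology l2_topology l2_topology) U"
    using T(1) by (auto simp: U_def closedin_def)
  then have "fsigma_in euclidean U"
    by (rule fsigma_l2_prod_open)
  then have "gdelta_in euclidean (- U)"
    by (simp add: gdelta_in_fsigma_in Compl_eq_Diff_UNIV[symmetric])
  then have "fsigmadelta_in euclidean (- U)"
    by (rule gdelta_imp_fsigmadelta_in[OF metrizable_space_euclidean])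
  moreover have "A = (?Q \<times> l2) \<inter> - U"
    using T(2) by (auto simp: U_def)
  ultimately show ?thesis
    using fsigmadelta_in_Int[OF fsigmadelta_Erdos_Times_l2] by simp
qed

text \<open>A homeomorphism from a product embeds the slice over a point \<open>y0\<close>. The
  graph of this embedding is closed in the product with \<open>l2\<close>, which would make it a
  weak F_sigma-delta set.\<close>

lemma not_Erdos_space_factor:
  "\<not> Erdos_space_factor TYPE('y) (subtopology l2_topology E_rat_norm)"
proof
  let ?X = "subtopology l2_topology E_rat_norm"
  assume "Erdos_space_factor TYPE('y) ?X"
  then obtain Y :: "'y topology" and \<phi> \<psi> where Y: "sm_space Y"
      and hm: "homeomorphic_maps (prod_topology ?X Y) Erdos_space \<phi> \<psi>"
    by (auto simp: Erdos_space_factor_def homeomorphic_space_def)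
  obtain y0 where y0: "y0 \<in> topspace Y" using Y unfolding sm_space_def by blast
  have c\<phi>: "continuous_map (prod_topology ?X Y) Erdos_space \<phi>"
    and c\<psi>: "continuous_map Erdos_space (prod_topology ?X Y) \<psi>"
    and \<psi>\<phi>: "\<And>z. z \<in> topspace (prod_topology ?X Y) \<Longrightarrow> \<psi> (\<phi> z) = z"
    and \<phi>\<psi>: "\<And>y. y \<in> topspace Erdos_space \<Longrightarrow> \<phi> (\<psi> y) = y"
    using hm by (auto simp: homeomorphic_maps_def)
  have tE: "topspace Erdos_space = {x \<in> l2. \<forall>n. x n \<in> \<rat>}"
    by (auto simp: Erdos_space_def)
  define h where "h x = \<phi> (x, y0)" for x
  have "continuous_map ?X (prod_topology ?X Y) (\<lambda>x. (x, y0))"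
    by (intro continuous_map_pairedI) (auto simp: y0)
  from continuous_map_compose[OF this c\<phi>] have ch: "continuous_map ?X Erdos_space h"
    by (simp add: o_def h_def[abs_def])
  have hE: "h x \<in> topspace Erdos_space" if "x \<in> E_rat_norm" for x
    using ch that topspace_E_rat_norm by (auto simp: continuous_map_def)
  interpret rational_map h
  proof
    have "continuous_map ?X l2_topology h"
      using ch by (simp add: Erdos_space_def continuous_map_in_subtopology)
    from continuous_map_compose[OF this continuous_map_l2_euclidean]
    show "continuous_map ?X euclidean h" by (simp add: o_def)
    show "h x i \<in> \<rat>" if "x \<in> E_rat_norm" for x i
      using hE[OF that] by (simp add: tE)
  qed
  let ?Z = "prod_topology Erdos_space l2_topology"
  have tZ: "topspace ?Z = topspace Erdos_space \<times> l2" by simp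
  \<comment> \<open>Two equations in the inverse \<open>\<psi>\<close> describe the graph: the
    \<open>Y\<close>-part of \<open>\<psi> (fst z)\<close> is \<open>y0\<close>, and its other part
    is \<open>snd z\<close>. Both sides are continuous with values in Hausdorff spaces, so the
    solutions form closed sets.\<close>
  have graph: "graph ` E_rat_norm =
      {z \<in> topspace ?Z. (snd \<circ> \<psi> \<circ> fst) z = y0} \<inter> {z \<in> topspace ?Z. (fst \<circ> \<psi> \<circ> fst) z = snd z}"
    (is "_ = ?A \<inter> ?B")
  proof (intro equalityI subsetI)
    fix z assume "z \<in> graph ` E_rat_norm"
    then obtain x where x: "x \<in> E_rat_norm" "z = (h x, x)" by (auto simp: graph_def)
    have "(x, y0) \<in> topspace (prod_topology ?X Y)"
      using x(1) y0 topspace_E_rat_norm by simp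
    then have "\<psi> (h x) = (x, y0)" unfolding h_def by (rule \<psi>\<phi>)
    then show "z \<in> ?A \<inter> ?B"
      using x hE[OF x(1)] E_rat_norm_subset_l2 by auto
  next
    fix z assume z: "z \<in> ?A \<inter> ?B"
    then have e: "fst z \<in> topspace Erdos_space" "\<psi> (fst z) = (snd z, y0)"
      by (auto simp: prod_eq_iff)
    have "\<psi> (fst z) \<in> topspace (prod_topology ?X Y)"
      using c\<psi> e(1) by (auto simp: continuous_map_def)
    then have "snd z \<in> E_rat_norm" using e(2) by simp
    moreover have "h (snd z) = fst z" using \<phi>\<psi>[OF e(1)] e(2) by (simp add: h_def)
    ultimately show "z \<in> graph ` E_rat_norm"
      by (intro image_eqI[of _ _ "snd z"]) (auto simp: graph_def prod_eq_iff)
  qed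
  have c\<psi>f: "continuous_map ?Z (prod_topology ?X Y) (\<psi> \<circ> fst)"
    by (rule continuous_map_compose[OF continuous_map_fst c\<psi>])
  have "closedin ?Z ?A"
  proof (rule closedin_continuous_maps_eq)
    show "Hausdorff_space Y"
      using Y by (simp add: sm_space_def metrizable_imp_Hausdorff_space)
    show "continuous_map ?Z Y (snd \<circ> \<psi> \<circ> fst)"
      using continuous_map_compose[OF c\<psi>f continuous_map_snd] by (simp add: o_assoc)
  qed (simp add: y0)
  moreover have "closedin ?Z ?B"
  proof (rule closedin_continuous_maps_eq)
    show "Hausdorff_space l2_topology"
      by (rule metrizable_imp_Hausdorff_space[OF metrizable_l2])
    have "continuous_map ?Z ?X (fst \<circ> \<psi> \<circ> fst)"
      using continuous_map_compose[OF c\<psi>f continuous_map_fst] by (simp add: o_assoc)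
    then show "continuous_map ?Z l2_topology (fst \<circ> \<psi> \<circ> fst)"
      by (simp add: continuous_map_in_subtopology)
  qed (rule continuous_map_snd)
  ultimately have "closedin ?Z (graph ` E_rat_norm)"
    unfolding graph by (rule closedin_Int)
  then show False
    using fsigmadelta_closed_in_Erdos_prod not_fsigmadelta_graph by blast
qed

theorem mainTheorem4:
  fixes X :: "(nat \<Rightarrow> real) topology"
  defines "X \<equiv> subtopology l2_topology (E_prime \<union> {x \<in> E_c. l2_norm x \<in> \<rat>})"
  shows "almost_zero_dimensional X
    \<and> absolute_fsigmadelta TYPE('z) X
    \<and> \<not> Erdos_space_factor TYPE('y) X"
proof -
  have X: "X = subtopology l2_topology E_rat_norm"
    by (simp add: X_def E_rat_norm_def)
  have azd: "almost_zero_dimensional X"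
    unfolding X by (rule almost_zero_dimensional_subset_E_c[OF E_rat_norm_subset_E_c E_rat_norm_nonempty])
  then have "absolute_fsigmadelta TYPE('z) X"
    unfolding X almost_zero_dimensional_def
    using absolute_fsigmadelta_completely_metrizable[OF completely_metrizable_l2 fsigmadelta_E_rat_norm] by blast
  with azd not_Erdos_space_factor show ?thesis
    unfolding X by blast
qed

end
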